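(* For any integer $d\ge 0$ the $U(\mathfrak{sl}_2)_e$-modules $L_{2d}^{(0)}$, $L_{2d+1}^{(0)}$, $L_{2d+1}^{(1)}$, $L_{2d+2}^{(1)}$ are all $(d+1)$-dimensional irreducible $U(\mathfrak{sl}_2)_e$-modules up to isomorphism; that is, each of these four modules is a $(d+1)$-dimensional irreducible $U(\mathfrak{sl}_2)_e$-module, and every $(d+1)$-dimensional irreducible $U(\mathfrak{sl}_2)_e$-module is isomorphic to one of them.
   Context: All algebras are unital associative algebras over $\mathbb C$, and $[x,y]=xy-yx$. $U(\mathfrak{sl}_2)$ is the algebra over $\mathbb C$ generated by $E,F,H$ subject to $[H,E]=2E$, $[H,F]=-2F$, $[E,F]=H$. It is $\mathbb Z$-graded by assigning degrees $1,-1,0$ to $E,F,H$ respectively; for $n\in\mathbb Z$ let $U_n$ denote the $n$-th homogeneous subspace, and define the subalgebra $U(\mathfrak{sl}_2)_e=\bigoplus_{n\in\mathbb Z}U_{2n}$. For each integer $n\ge 0$, $L_n$ is the $(n+1)$-dimensional irreducible $U(\mathfrak{sl}_2)$-module with basis $\{v_i\}_{i=0}^n$ such that $Ev_i=(n-i+1)v_{i-1}$ $(1\le i\le n)$, $Ev_0=0$; $Fv_i=(i+1)v_{i+1}$ $(0\le i\le n-1)$, $Fv_n=0$; $Hv_i=(n-2i)v_i$ $(0\le i\le n)$. For a $U(\mathfrak{sl}_2)$-module $V$ and $\theta\in\mathbb C$ let $V(\theta)=\{v\in V\mid Hv=\theta v\}$. For $n\ge 0$ let $L_n^{(0)}=\bigoplus_{i\in\mathbb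 Z}L_n(n-4i)$, and for $n\ge 1$ let $L_n^{(1)}=\bigoplus_{i\in\mathbb Z}L_n(n-4i-2)$. These are $U(\mathfrak{sl}_2)_e$-submodules of $L_n$. *)

theory Defs
  imports Complex_Main "HOL-Library.Poly_Mapping"
begin

text \<open>
  Finitely supported functions \<open>'k \<Rightarrow>\<^sub>0 complex\<close> serve both as the free algebra (with \<open>'k\<close> the
  free monoid of words) and as the vector space with basis indexed by \<open>'k\<close>.
\<close>

definition pm_scale :: "complex \<Rightarrow> ('k \<Rightarrow>\<^sub>0 complex) \<Rightarrow> ('k \<Rightarrow>\<^sub>0 complex)" where
  "pm_scale c p = Poly_Mapping.map ((*) c) p"

lemma lookup_pm_scale [simp]: "Poly_Mapping.lookup (pm_scale c p) k = c * Poly_Mapping.lookup p k"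
  unfolding pm_scale_def by (transfer, auto simp: when_def)

global_interpretation pm: vector_space pm_scale
  defines pm_span = pm.span
  by unfold_locales (auto intro!: poly_mapping_eqI simp: lookup_add algebra_simps)

lemma pm_scale_mult_left: "pm_scale c p * q = pm_scale c (p * q)"
  for p q :: "'k::monoid_add \<Rightarrow>\<^sub>0 complex"
  by (simp add: pm_scale_def mult_map_scale_conv_mult mult.assoc)

lemma single_0_central: "Poly_Mapping.single 0 c * p = p * Poly_Mapping.single 0 c" for p :: "'k::monoid_add \<Rightarrow>\<^sub>0 complex"
proof (induction p rule: update_induct)
  case (update p a b)
  have "Poly_Mapping.update a b p = p + Poly_Mapping.single a b"
    using update by (intro poly_mapping_eqI) (auto simp: lookup_update lookup_add lookup_single in_keys_iff)
  with update show ?case by (simp add: algebra_simps mult_single)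
qed simp

lemma pm_scale_mult_right: "p * pm_scale c q = pm_scale c (p * q)"
  for p q :: "'k::monoid_add \<Rightarrow>\<^sub>0 complex"
  by (metis pm_scale_def mult_map_scale_conv_mult mult.assoc single_0_central)

lemma pm_scale_single: "pm_scale c (Poly_Mapping.single k a) = Poly_Mapping.single k (c * a)"
  by (intro poly_mapping_eqI) (auto simp: lookup_single when_def)

text \<open>The linear extension of a map defined on the basis.\<close>

definition lin_ext :: "('k \<Rightarrow> ('m \<Rightarrow>\<^sub>0 complex)) \<Rightarrow> ('k \<Rightarrow>\<^sub>0 complex) \<Rightarrow> ('m \<Rightarrow>\<^sub>0 complex)" where
  "lin_ext b p = (\<Sum>k\<in>Poly_Mapping.keys p. pm_scale (Poly_Mapping.lookup p k) (b k))"

lemma lin_ext_superset: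
  assumes "finite S" "Poly_Mapping.keys p \<subseteq> S"
  shows "lin_ext b p = (\<Sum>k\<in>S. pm_scale (Poly_Mapping.lookup p k) (b k))"
  unfolding lin_ext_def using assms
  by (intro sum.mono_neutral_left) (auto simp: in_keys_iff)

lemma lin_ext_0 [simp]: "lin_ext b 0 = 0"
  by (simp add: lin_ext_def)

lemma lin_ext_add: "lin_ext b (p + q) = lin_ext b p + lin_ext b q"
proof -
  let ?S = "Poly_Mapping.keys p \<union> Poly_Mapping.keys q"
  have "lin_ext b (p + q) = (\<Sum>k\<in>?S. pm_scale (Poly_Mapping.lookup (p + q) k) (b k))"
    by (rule lin_ext_superset) (use keys_add[of p q] in auto)
  also have "\<dots> = (\<Sum>k\<in>?S. pm_scale (Poly_Mapping.lookup p k) (b k)) + (\<Sum>k\<in>?S. pm_scale (Poly_Mapping.lookup q k) (b k))"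
    by (simp add: lookup_add pm.scale_left_distrib sum.distrib)
  also have "\<dots> = lin_ext b p + lin_ext b q"
    by (simp add: lin_ext_superset[of ?S])
  finally show ?thesis .
qed

lemma lin_ext_scale: "lin_ext b (pm_scale c p) = pm_scale c (lin_ext b p)"
proof -
  have "lin_ext b (pm_scale c p) = (\<Sum>k\<in>Poly_Mapping.keys p. pm_scale (Poly_Mapping.lookup (pm_scale c p) k) (b k))"
    by (rule lin_ext_superset) (auto simp: in_keys_iff)
  then show ?thesis
    by (simp add: lin_ext_def pm.scale_sum_right)
qed

lemma lin_ext_uminus: "lin_ext b (- p) = - lin_ext b p"
  by (metis lin_ext_scale pm.scale_minus_left pm.scale_one)

lemma lin_ext_diff: "lin_ext b (p - q) = lin_ext b p - lin_ext b q"
  using lin_ext_add[of b p "- q"] by (simp add: lin_ext_uminus)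

lemma lin_ext_single [simp]: "lin_ext b (Poly_Mapping.single k c) = pm_scale c (b k)"
  by (cases "c = 0") (auto simp: lin_ext_def)

lemma pm_induct [case_names zero add]:
  assumes "P 0" "\<And>k c p. P p \<Longrightarrow> P (p + Poly_Mapping.single k c)"
  shows "P (p :: 'k \<Rightarrow>\<^sub>0 complex)"
proof (induction p rule: update_induct)
  case (update p a b)
  have "Poly_Mapping.update a b p = p + Poly_Mapping.single a b"
    using update by (intro poly_mapping_eqI) (auto simp: lookup_update lookup_add lookup_single in_keys_iff)
  with update assms(2) show ?case by simp
qed (rule assms(1))


section \<open>The algebra \<open>U(sl\<^sub>2)\<close>: the free algebra on three generators modulo the relations\<close>

datatype gen = GE | GF | GH

datatype gword = Word (letters: "gen list")

instantiation gword :: monoid_add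
begin
definition "0 = Word []"
definition "u + v = Word (letters u @ letters v)"
instance by standard (auto simp: zero_gword_def plus_gword_def)
end

type_synonym free_alg = "gword \<Rightarrow>\<^sub>0 complex"

definition free_gen :: "gen \<Rightarrow> free_alg" where
  "free_gen g = Poly_Mapping.single (Word [g]) 1"

inductive_set sl2_ideal :: "free_alg set" where
  rel_HE: "free_gen GH * free_gen GE - free_gen GE * free_gen GH - pm_scale 2 (free_gen GE) \<in> sl2_ideal"
| rel_HF: "free_gen GH * free_gen GF - free_gen GF * free_gen GH + pm_scale 2 (free_gen GF) \<in> sl2_ideal"
| rel_EF: "free_gen GE * free_gen GF - free_gen GF * free_gen GE - free_gen GH \<in> sl2_ideal"
| zero: "0 \<in> sl2_ideal"
| add: "x \<in> sl2_ideal \<Longrightarrow> y \<in> sl2_ideal \<Longrightarrow> x + y \<in> sl2_ideal"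
| mult: "x \<in> sl2_ideal \<Longrightarrow> a * x * b \<in> sl2_ideal"

lemma sl2_ideal_left: "x \<in> sl2_ideal \<Longrightarrow> a * x \<in> sl2_ideal"
  using sl2_ideal.mult[of x a 1] by simp

lemma sl2_ideal_right: "x \<in> sl2_ideal \<Longrightarrow> x * a \<in> sl2_ideal"
  using sl2_ideal.mult[of x 1 a] by simp

lemma sl2_ideal_uminus: "x \<in> sl2_ideal \<Longrightarrow> - x \<in> sl2_ideal"
  using sl2_ideal_left[of x "- 1"] by simp

lemma sl2_ideal_scale: "x \<in> sl2_ideal \<Longrightarrow> pm_scale c x \<in> sl2_ideal"
  using sl2_ideal_left[of x "pm_scale c 1"] by (simp add: pm_scale_mult_left)

definition sl2_rel :: "free_alg \<Rightarrow> free_alg \<Rightarrow> bool" where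
  "sl2_rel x y \<longleftrightarrow> x - y \<in> sl2_ideal"

lemma equivp_sl2_rel: "equivp sl2_rel"
proof (rule equivpI)
  show "reflp sl2_rel" by (auto intro!: reflpI simp: sl2_rel_def sl2_ideal.zero)
  show "symp sl2_rel" using sl2_ideal_uminus by (fastforce intro!: sympI simp: sl2_rel_def)
  show "transp sl2_rel" using sl2_ideal.add by (fastforce intro!: transpI simp: sl2_rel_def)
qed

quotient_type usl2 = free_alg / sl2_rel
  by (rule equivp_sl2_rel)

lemma one_free_alg_notin_sl2_ideal: "(1 :: free_alg) \<notin> sl2_ideal"
proof
  have "x \<in> sl2_ideal \<Longrightarrow> Poly_Mapping.lookup x 0 = 0" for x
  proof -
    have [simp]: "free_gen g * free_gen h = Poly_Mapping.single (Word [g, h]) 1" for g h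
      by (simp add: free_gen_def mult_single plus_gword_def)
    have mult0: "Poly_Mapping.lookup (p * q) 0 = Poly_Mapping.lookup p 0 * Poly_Mapping.lookup q 0" for p q :: free_alg
    proof (induction p rule: pm_induct)
      case (add k c p)
      have "Poly_Mapping.lookup (Poly_Mapping.single k c * q) 0 = Poly_Mapping.lookup (Poly_Mapping.single k c) 0 * Poly_Mapping.lookup q 0"
      proof (induction q rule: pm_induct)
        case (add k' c' q)
        then show ?case
          by (cases k; cases k')
            (auto simp: algebra_simps lookup_add mult_single lookup_single when_def plus_gword_def zero_gword_def)
      qed simp
      with add show ?case by (simp add: algebra_simps lookup_add)
    qed simp
    show "x \<in> sl2_ideal \<Longrightarrow> Poly_Mapping.lookup x 0 = 0"
      by (induction rule: sl2_ideal.induct)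
        (auto simp: lookup_add lookup_minus mult0[unfolded zero_gword_def] free_gen_def lookup_single when_def zero_gword_def
          mult_single plus_gword_def)
  qed
  moreover assume "(1 :: free_alg) \<in> sl2_ideal"
  ultimately show False by fastforce
qed

instantiation usl2 :: ring_1
begin

lift_definition zero_usl2 :: usl2 is 0 .
lift_definition one_usl2 :: usl2 is 1 .
lift_definition plus_usl2 :: "usl2 \<Rightarrow> usl2 \<Rightarrow> usl2" is "(+)"
  using sl2_ideal.add by (fastforce simp: sl2_rel_def algebra_simps)
lift_definition uminus_usl2 :: "usl2 \<Rightarrow> usl2" is uminus
  using sl2_ideal_uminus by (fastforce simp: sl2_rel_def)
lift_definition minus_usl2 :: "usl2 \<Rightarrow> usl2 \<Rightarrow> usl2" is "(-)"
proof -
  fix a b c d assume "sl2_rel a b" "sl2_rel c d"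
  then have "(a - b) + - (c - d) \<in> sl2_ideal"
    unfolding sl2_rel_def by (intro sl2_ideal.add sl2_ideal_uminus)
  then show "sl2_rel (a - c) (b - d)" by (simp add: sl2_rel_def algebra_simps)
qed
lift_definition times_usl2 :: "usl2 \<Rightarrow> usl2 \<Rightarrow> usl2" is "(*)"
proof -
  fix a b c d assume "sl2_rel a b" "sl2_rel c d"
  then have "(a - b) * c + b * (c - d) \<in> sl2_ideal"
    unfolding sl2_rel_def by (intro sl2_ideal.add sl2_ideal_left sl2_ideal_right)
  then show "sl2_rel (a * c) (b * d)" by (simp add: sl2_rel_def algebra_simps)
qed

instance
proof
  fix a b c :: usl2
  show "a * b * c = a * (b * c)" "1 * a = a" "a * 1 = a" "a + b + c = a + (b + c)"
    "a + b = b + a" "0 + a = a" "- a + a = 0" "a - b = a + - b"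
    "(a + b) * c = a * c + b * c" "a * (b + c) = a * b + a * c"
    by (transfer, simp add: sl2_rel_def algebra_simps sl2_ideal.zero)+
  show "0 \<noteq> (1 :: usl2)"
    by transfer (use one_free_alg_notin_sl2_ideal sl2_ideal_uminus in \<open>fastforce simp: sl2_rel_def\<close>)
qed

end

lift_definition usl2_scale :: "complex \<Rightarrow> usl2 \<Rightarrow> usl2" is pm_scale
  by (simp add: sl2_rel_def sl2_ideal_scale flip: pm.scale_right_diff_distrib)

global_interpretation usl2: vector_space usl2_scale
  defines usl2_span = usl2.span
  by unfold_locales
    (transfer, simp add: sl2_rel_def pm.scale_left_distrib pm.scale_right_distrib sl2_ideal.zero)+

lemma usl2_scale_mult_left: "usl2_scale c x * y = usl2_scale c (x * y)"
  by transfer (simp add: sl2_rel_def pm_scale_mult_left sl2_ideal.zero)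

lemma usl2_scale_mult_right: "x * usl2_scale c y = usl2_scale c (x * y)"
  by transfer (simp add: sl2_rel_def pm_scale_mult_right sl2_ideal.zero)

lift_definition usl2_gen :: "gen \<Rightarrow> usl2" is free_gen .

abbreviation "uE \<equiv> usl2_gen GE"
abbreviation "uF \<equiv> usl2_gen GF"
abbreviation "uH \<equiv> usl2_gen GH"

lemma usl2_relations:
  "uH * uE - uE * uH = usl2_scale 2 uE"
  "uH * uF - uF * uH = usl2_scale (- 2) uF"
  "uE * uF - uF * uE = uH"
  by (transfer, use sl2_ideal.rel_HE sl2_ideal.rel_HF sl2_ideal.rel_EF in \<open>simp add: sl2_rel_def\<close>)+


section \<open>The \<open>\<int>\<close>-grading and the even subalgebra\<close>

fun gen_deg :: "gen \<Rightarrow> int" where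
  "gen_deg GE = 1"
| "gen_deg GF = - 1"
| "gen_deg GH = 0"

text \<open>
  The relations are homogeneous, so the homogeneous subspace of degree \<open>n\<close> is the image of the span
  of the words of total degree \<open>n\<close>.
\<close>

definition usl2_hom :: "int \<Rightarrow> usl2 set" where
  "usl2_hom n = usl2_span {prod_list (map usl2_gen gs) | gs. sum_list (map gen_deg gs) = n}"

text \<open>
  Here, and in the submodules of \<open>L\<^sub>n\<close> below, the direct sum is internal: the span of the union of
  a family of independent subspaces.
\<close>

definition usl2_even :: "usl2 set" where
  "usl2_even = usl2_span (\<Union>n. usl2_hom (2 * n))"

lemma usl2_hom_mult:
  assumes "x \<in> usl2_hom m" "y \<in> usl2_hom n"
  shows "x * y \<in> usl2_hom (m + n)"
proof -
  have *: "prod_list (map usl2_gen gs) * y \<in> usl2_hom (sum_list (map gen_deg gs) + n)" for gs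
    using assms(2) unfolding usl2_hom_def[of n]
  proof (induction y rule: usl2.span_induct_alt)
    case base
    then show ?case by (simp add: usl2_hom_def usl2.span_zero)
  next
    case (step c x y)
    then obtain hs where hs: "x = prod_list (map usl2_gen hs)" "sum_list (map gen_deg hs) = n" by auto
    have "prod_list (map usl2_gen (gs @ hs)) \<in> usl2_hom (sum_list (map gen_deg gs) + n)"
      unfolding usl2_hom_def by (rule usl2.span_base) (use hs in \<open>auto intro!: exI[of _ "gs @ hs"]\<close>)
    with step hs show ?case
      by (simp add: distrib_left usl2_scale_mult_right usl2_hom_def usl2.span_add usl2.span_scale)
  qed
  show ?thesis
    using assms(1) unfolding usl2_hom_def[of m]
  proof (induction x rule: usl2.span_induct_alt)
    case base
    then show ?case by (simp add: usl2_hom_def usl2.span_zero)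
  next
    case (step c x z)
    then have "x * y \<in> usl2_hom (m + n)" using * by auto
    with step show ?case
      by (simp add: distrib_right usl2_scale_mult_left usl2_hom_def usl2.span_add usl2.span_scale)
  qed
qed

lemma usl2_even_subalgebra:
  "usl2.subspace usl2_even"
  "1 \<in> usl2_even"
  "x \<in> usl2_even \<Longrightarrow> y \<in> usl2_even \<Longrightarrow> x * y \<in> usl2_even"
proof -
  show "usl2.subspace usl2_even" by (simp add: usl2_even_def usl2.subspace_span)
  have "1 \<in> usl2_hom (2 * 0)"
    unfolding usl2_hom_def by (rule usl2.span_base) (auto intro!: exI[of _ "[]"])
  then show "1 \<in> usl2_even" unfolding usl2_even_def by (blast intro: usl2.span_base)
  have *: "x * y \<in> usl2_even" if "x \<in> usl2_hom (2 * m)" "y \<in> usl2_even" for x y m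
    using that(2) unfolding usl2_even_def
  proof (induction y rule: usl2.span_induct_alt)
    case base
    then show ?case by (simp add: usl2.span_zero)
  next
    case (step c u z)
    then obtain n where "u \<in> usl2_hom (2 * n)" by auto
    with that have "x * u \<in> usl2_hom (2 * (m + n))"
      using usl2_hom_mult[of x "2 * m" u "2 * n"] by (simp add: algebra_simps)
    then have "x * u \<in> usl2_span (\<Union>n. usl2_hom (2 * n))" by (blast intro: usl2.span_base)
    with step show ?case
      by (simp add: distrib_left usl2_scale_mult_right usl2.span_add usl2.span_scale)
  qed
  show "x * y \<in> usl2_even" if "x \<in> usl2_even" "y \<in> usl2_even"
    using that(1) unfolding usl2_even_def[of]
  proof (induction x rule: usl2.span_induct_alt)
    case base
    then show ?case by (simp add: usl2.span_zero)
  next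
    case (step c u z)
    then have "u * y \<in> usl2_span (\<Union>n. usl2_hom (2 * n))"
      using * that(2) by (auto simp flip: usl2_even_def)
    with step show ?case
      by (simp add: distrib_right usl2_scale_mult_left usl2.span_add usl2.span_scale)
  qed
qed


section \<open>Modules over subalgebras of \<open>U(sl\<^sub>2)\<close>\<close>

text \<open>
  The carrier is a subspace of an ambient complex vector space, so that submodules of a module live
  on the same type. For a module over a subalgebra \<open>A\<close>, the values of \<open>act\<close> outside \<open>A\<close> and
  outside the carrier are irrelevant.
\<close>

record 'v umod =
  carrier :: "'v set"
  smult :: "complex \<Rightarrow> 'v \<Rightarrow> 'v"
  act :: "usl2 \<Rightarrow> 'v \<Rightarrow> 'v"

definition is_umod :: "usl2 set \<Rightarrow> 'v::ab_group_add umod \<Rightarrow> bool" where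
  "is_umod A M \<longleftrightarrow>
     vector_space (smult M) \<and>
     module.subspace (smult M) (carrier M) \<and>
     (\<forall>a\<in>A. \<forall>v\<in>carrier M. act M a v \<in> carrier M) \<and>
     (\<forall>a\<in>A. \<forall>v\<in>carrier M. \<forall>w\<in>carrier M. act M a (v + w) = act M a v + act M a w) \<and>
     (\<forall>a\<in>A. \<forall>c. \<forall>v\<in>carrier M. act M a (smult M c v) = smult M c (act M a v)) \<and>
     (\<forall>a\<in>A. \<forall>b\<in>A. \<forall>v\<in>carrier M. act M (a + b) v = act M a v + act M b v) \<and>
     (\<forall>a\<in>A. \<forall>c. \<forall>v\<in>carrier M. act M (usl2_scale c a) v = smult M c (act M a v)) \<and>
     (\<forall>a\<in>A. \<forall>b\<in>A. \<forall>v\<in>carrier M. act M (a * b) v = act M a (act M b v)) \<and>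
     (\<forall>v\<in>carrier M. act M 1 v = v)"

definition is_submodule :: "usl2 set \<Rightarrow> 'v::ab_group_add set \<Rightarrow> 'v umod \<Rightarrow> bool" where
  "is_submodule A W M \<longleftrightarrow>
     W \<subseteq> carrier M \<and> module.subspace (smult M) W \<and> (\<forall>a\<in>A. \<forall>w\<in>W. act M a w \<in> W)"

definition irreducible_umod :: "usl2 set \<Rightarrow> 'v::ab_group_add umod \<Rightarrow> bool" where
  "irreducible_umod A M \<longleftrightarrow>
     is_umod A M \<and> carrier M \<noteq> {0} \<and> (\<forall>W. is_submodule A W M \<longrightarrow> W = {0} \<or> W = carrier M)"

text \<open>\<open>vector_space.dim\<close> is \<open>0\<close> on infinite-dimensional spaces.\<close>

definition umod_dim :: "'v::ab_group_add umod \<Rightarrow> nat" where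
  "umod_dim M = vector_space.dim (smult M) (carrier M)"

definition umod_iso :: "usl2 set \<Rightarrow> 'v::ab_group_add umod \<Rightarrow> 'w::ab_group_add umod \<Rightarrow> bool" where
  "umod_iso A M N \<longleftrightarrow>
     (\<exists>f. bij_betw f (carrier M) (carrier N) \<and>
          (\<forall>v\<in>carrier M. \<forall>w\<in>carrier M. f (v + w) = f v + f w) \<and>
          (\<forall>c. \<forall>v\<in>carrier M. f (smult M c v) = smult N c (f v)) \<and>
          (\<forall>a\<in>A. \<forall>v\<in>carrier M. f (act M a v) = act N a (f v)))"

definition weight_space :: "'v umod \<Rightarrow> complex \<Rightarrow> 'v set" where
  "weight_space M \<theta> = {v \<in> carrier M. act M uH v = smult M \<theta> v}"


section \<open>The modules \<open>L\<^sub>n\<close> and their even and odd parts\<close>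

text \<open>
  The vector \<open>v\<^sub>i\<close> is \<open>bvec i\<close>. All three generators are made to act by \<open>0\<close> on the irrelevant
  basis vectors \<open>v\<^sub>i\<close> with \<open>i > n\<close>; the ambient space then satisfies the relations
  of \<open>U(sl\<^sub>2)\<close>, and \<open>L\<^sub>n\<close> is its submodule spanned by \<open>v\<^sub>0, \<dots>, v\<^sub>n\<close>.
\<close>

abbreviation bvec :: "nat \<Rightarrow> (nat \<Rightarrow>\<^sub>0 complex)" where
  "bvec i \<equiv> Poly_Mapping.single i 1"

fun L_basis_act :: "nat \<Rightarrow> gen \<Rightarrow> nat \<Rightarrow> (nat \<Rightarrow>\<^sub>0 complex)" where
  "L_basis_act n GE i =
     (if 1 \<le> i \<and> i \<le> n then pm_scale (of_nat n - of_nat i + 1) (bvec (i - 1)) else 0)"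
| "L_basis_act n GF i = (if i < n then pm_scale (of_nat i + 1) (bvec (i + 1)) else 0)"
| "L_basis_act n GH i = (if i \<le> n then pm_scale (of_nat n - 2 * of_nat i) (bvec i) else 0)"

definition L_gen_act :: "nat \<Rightarrow> gen \<Rightarrow> (nat \<Rightarrow>\<^sub>0 complex) \<Rightarrow> (nat \<Rightarrow>\<^sub>0 complex)" where
  "L_gen_act n g = lin_ext (L_basis_act n g)"

definition L_word_act :: "nat \<Rightarrow> gword \<Rightarrow> (nat \<Rightarrow>\<^sub>0 complex) \<Rightarrow> (nat \<Rightarrow>\<^sub>0 complex)" where
  "L_word_act n w = foldr (L_gen_act n) (letters w)"

definition L_free_act :: "nat \<Rightarrow> free_alg \<Rightarrow> (nat \<Rightarrow>\<^sub>0 complex) \<Rightarrow> (nat \<Rightarrow>\<^sub>0 complex)" where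
  "L_free_act n p v = lin_ext (\<lambda>w. L_word_act n w v) p"

lemma L_word_act_linear:
  "L_word_act n w (u + v) = L_word_act n w u + L_word_act n w v"
  "L_word_act n w (pm_scale c v) = pm_scale c (L_word_act n w v)"
  "L_word_act n w 0 = 0"
proof -
  have "foldr (L_gen_act n) gs (u + v) = foldr (L_gen_act n) gs u + foldr (L_gen_act n) gs v"
    "foldr (L_gen_act n) gs (pm_scale c v) = pm_scale c (foldr (L_gen_act n) gs v)"
    "foldr (L_gen_act n) gs 0 = 0" for gs
    by (induction gs) (auto simp: L_gen_act_def lin_ext_add lin_ext_scale)
  then show
    "L_word_act n w (u + v) = L_word_act n w u + L_word_act n w v"
    "L_word_act n w (pm_scale c v) = pm_scale c (L_word_act n w v)"
    "L_word_act n w 0 = 0"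
    by (simp_all add: L_word_act_def)
qed

lemma L_free_act_add_left: "L_free_act n (p + q) v = L_free_act n p v + L_free_act n q v"
  by (simp add: L_free_act_def lin_ext_add)

lemma L_free_act_diff_left: "L_free_act n (p - q) v = L_free_act n p v - L_free_act n q v"
  by (simp add: L_free_act_def lin_ext_diff)

lemma L_free_act_scale_left: "L_free_act n (pm_scale c p) v = pm_scale c (L_free_act n p v)"
  by (simp add: L_free_act_def lin_ext_scale)

lemma L_free_act_single: "L_free_act n (Poly_Mapping.single w c) v = pm_scale c (L_word_act n w v)"
  by (simp add: L_free_act_def)

lemma L_free_act_gen: "L_free_act n (free_gen g) v = L_gen_act n g v"
  by (simp add: free_gen_def L_free_act_single L_word_act_def)

lemma L_free_act_right:
  "L_free_act n p (u + v) = L_free_act n p u + L_free_act n p v"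
  "L_free_act n p (pm_scale c v) = pm_scale c (L_free_act n p v)"
  "L_free_act n p 0 = 0"
  by (simp_all add: L_free_act_def lin_ext_def L_word_act_linear pm.scale_right_distrib
      sum.distrib pm.scale_sum_right mult.commute)

lemma L_word_act_plus: "L_word_act n (a + b) v = L_word_act n a (L_word_act n b v)"
  by (simp add: L_word_act_def plus_gword_def)

lemma L_free_act_mult: "L_free_act n (p * q) v = L_free_act n p (L_free_act n q v)"
proof (induction p rule: pm_induct)
  case zero
  then show ?case by (simp add: L_free_act_def)
next
  case (add k c p)
  have "L_free_act n (Poly_Mapping.single k c * q) v = L_free_act n (Poly_Mapping.single k c) (L_free_act n q v)"
  proof (induction q rule: pm_induct)
    case zero
    then show ?case by (simp add: L_free_act_def L_word_act_linear)
  next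
    case (add k' c' q)
    then show ?case
      by (simp add: distrib_left L_free_act_add_left mult_single L_free_act_single
          L_word_act_linear L_word_act_plus pm.scale_right_distrib)
  qed
  with add show ?case by (simp add: distrib_right L_free_act_add_left)
qed

lemma L_gen_act_bvec: "L_gen_act n g (bvec i) = L_basis_act n g i"
  by (simp add: L_gen_act_def)

lemma L_gen_act_scale: "L_gen_act n g (pm_scale c v) = pm_scale c (L_gen_act n g v)"
  by (simp add: L_gen_act_def lin_ext_scale)

lemma L_gen_act_uminus: "L_gen_act n g (- v) = - L_gen_act n g v"
  by (simp add: L_gen_act_def lin_ext_uminus)

lemma L_gen_act_0: "L_gen_act n g 0 = 0"
  by (simp add: L_gen_act_def)

lemma L_free_act_eq_0_from_bvec:
  assumes "\<And>i. L_free_act n p (bvec i) = 0"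
  shows "L_free_act n p v = 0"
proof (induction v rule: pm_induct)
  case (add k c v)
  have "Poly_Mapping.single k c = pm_scale c (bvec k)" by (simp add: pm_scale_single)
  with add assms show ?case by (simp add: L_free_act_right)
qed (simp add: L_free_act_right)

lemmas L_free_act_simps =
  L_free_act_diff_left L_free_act_add_left L_free_act_scale_left L_free_act_mult L_free_act_gen
  L_gen_act_bvec L_gen_act_scale L_gen_act_0 L_gen_act_uminus
  lookup_minus lookup_add

lemma L_free_act_ideal: "p \<in> sl2_ideal \<Longrightarrow> L_free_act n p v = 0"
proof (induction arbitrary: v rule: sl2_ideal.induct)
  case rel_HE
  show ?case
  proof (rule L_free_act_eq_0_from_bvec, rule poly_mapping_eqI)
    show "Poly_Mapping.lookup (L_free_act n (free_gen GH * free_gen GE - free_gen GE * free_gen GH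
        - pm_scale 2 (free_gen GE)) (bvec i)) k = Poly_Mapping.lookup 0 k" for i k
      by (cases i; auto simp: L_free_act_simps simp del: single_one; simp add: algebra_simps)
  qed
next
  case rel_HF
  show ?case
  proof (rule L_free_act_eq_0_from_bvec, rule poly_mapping_eqI)
    show "Poly_Mapping.lookup (L_free_act n (free_gen GH * free_gen GF - free_gen GF * free_gen GH
        + pm_scale 2 (free_gen GF)) (bvec i)) k = Poly_Mapping.lookup 0 k" for i k
      by (simp add: L_free_act_simps del: single_one, simp add: algebra_simps)
  qed
next
  case rel_EF
  show ?case
  proof (rule L_free_act_eq_0_from_bvec, rule poly_mapping_eqI)
    fix i k
    consider "n < i" | "i = n" | "i < n" by linarith
    then show "Poly_Mapping.lookup (L_free_act n (free_gen GE * free_gen GF - free_gen GF * free_gen GE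
        - free_gen GH) (bvec i)) k = Poly_Mapping.lookup 0 k"
    proof cases
      case 1
      then show ?thesis by (simp add: L_free_act_simps del: single_one)
    next
      case 2
      then show ?thesis
        by (cases n; simp add: L_free_act_simps del: single_one; simp add: algebra_simps)
    next
      case 3
      then show ?thesis
        by (cases i; simp add: L_free_act_simps del: single_one; simp add: algebra_simps)
    qed
  qed
qed (simp_all add: L_free_act_add_left L_free_act_mult L_free_act_right,
     simp_all add: L_free_act_def)

lift_definition L_act :: "nat \<Rightarrow> usl2 \<Rightarrow> (nat \<Rightarrow>\<^sub>0 complex) \<Rightarrow> (nat \<Rightarrow>\<^sub>0 complex)" is L_free_act
proof (rule ext)
  fix n p q v
  assume "sl2_rel p q"
  then have "L_free_act n (p - q) v = 0" by (simp add: sl2_rel_def L_free_act_ideal)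
  then show "L_free_act n p v = L_free_act n q v" by (simp add: L_free_act_diff_left)
qed

definition L_mod :: "nat \<Rightarrow> (nat \<Rightarrow>\<^sub>0 complex) umod" where
  "L_mod n = \<lparr>carrier = pm_span (bvec ` {0..n}), smult = pm_scale, act = L_act n\<rparr>"

definition L_mod0 :: "nat \<Rightarrow> (nat \<Rightarrow>\<^sub>0 complex) umod" where
  "L_mod0 n = (L_mod n)
     \<lparr>carrier := pm_span (\<Union>i::int. weight_space (L_mod n) (of_nat n - 4 * of_int i))\<rparr>"

definition L_mod1 :: "nat \<Rightarrow> (nat \<Rightarrow>\<^sub>0 complex) umod" where
  "L_mod1 n = (L_mod n)
     \<lparr>carrier := pm_span (\<Union>i::int. weight_space (L_mod n) (of_nat n - 4 * of_int i - 2))\<rparr>"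

lemma L_act_gen: "L_act n (usl2_gen g) (bvec i) = L_basis_act n g i"
  by transfer (simp add: L_free_act_gen L_gen_act_bvec)

lemma L_act_1: "L_act n 1 v = v"
  by transfer (simp add: L_free_act_single L_word_act_def zero_gword_def flip: single_one)

lemma L_act_linear:
  "L_act n a (u + v) = L_act n a u + L_act n a v"
  "L_act n a (pm_scale c v) = pm_scale c (L_act n a v)"
  "L_act n a 0 = 0"
  "L_act n (a + b) v = L_act n a v + L_act n b v"
  "L_act n (usl2_scale c a) v = pm_scale c (L_act n a v)"
  "L_act n (a * b) v = L_act n a (L_act n b v)"
  by (transfer; simp add: L_free_act_right L_free_act_add_left L_free_act_scale_left L_free_act_mult)+

lemma L_mod_is_umod: "is_umod UNIV (L_mod n)"
proof -
  let ?C = "pm_span (bvec ` {0..n})"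
  have gen: "L_gen_act n g v \<in> ?C" if "v \<in> ?C" for g v
    using that
  proof (induction v rule: pm.span_induct_alt)
    case base
    then show ?case by (simp add: L_gen_act_0 pm.span_zero)
  next
    case (step c x y)
    then obtain i where "x = bvec i" "i \<le> n" by auto
    have base: "bvec j \<in> ?C" if "j \<le> n" for j using that by (intro pm.span_base) simp
    from \<open>x = bvec i\<close> \<open>i \<le> n\<close> have "L_gen_act n g x \<in> ?C"
      using base by (cases g) (simp_all add: L_gen_act_bvec pm.span_zero pm.span_scale del: single_one)
    with step show ?case
      by (simp add: L_gen_act_def lin_ext_add lin_ext_scale pm.span_add pm.span_scale)
  qed
  have word: "L_word_act n w v \<in> ?C" if "v \<in> ?C" for w v
  proof -
    have "foldr (L_gen_act n) gs v \<in> ?C" for gs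
      by (induction gs) (auto simp: that gen)
    then show ?thesis by (simp add: L_word_act_def)
  qed
  have "L_free_act n p v \<in> ?C" if "v \<in> ?C" for p v
    unfolding L_free_act_def lin_ext_def using word[OF that] by (intro pm.span_sum pm.span_scale)
  then have closed: "L_act n a v \<in> ?C" if "v \<in> ?C" for a v
    using that by (simp add: L_act.rep_eq)
  show ?thesis
    by (simp add: is_umod_def L_mod_def L_act_linear L_act_1 closed pm.vector_space_axioms pm.subspace_span)
qed

end

theory Submission
  imports Defs "HOL-Computational_Algebra.Fundamental_Theorem_Algebra"
begin

text \<open>
  The even subalgebra is generated by \<open>E\<^sup>2\<close>, \<open>F\<^sup>2\<close>, \<open>H\<close> and the Casimir element \<open>4 F E + H\<^sup>2 + 2 H\<close>, which is
  central (\<open>usl2_even_induct\<close>). Therefore modules over it are treated like \<open>sl\<^sub>2\<close>-modules, with \<open>E\<^sup>2\<close> and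
  \<open>F\<^sup>2\<close> in place of \<open>E\<close> and \<open>F\<close>: these shift the weight by \<open>4\<close> and \<open>- 4\<close>, and on a common eigenvector of \<open>H\<close> and
  the Casimir element, with eigenvalues \<open>\<theta>\<close> and \<open>c\<close>, the elements \<open>F\<^sup>2 E\<^sup>2\<close> and \<open>E\<^sup>2 F\<^sup>2\<close> act by
  \<open>(c - \<theta>\<^sup>2 - 2 \<theta>) (c - \<theta>\<^sup>2 - 6 \<theta> - 8) / 16\<close> and \<open>(c - \<theta>\<^sup>2 + 2 \<theta>) (c - \<theta>\<^sup>2 + 6 \<theta> - 8) / 16\<close>.

  In an irreducible module of dimension \<open>d + 1\<close> there is such an eigenvector killed by \<open>E\<^sup>2\<close>
  (\<open>highest_weight_vector_exists\<close>). Its images under the powers of \<open>F\<^sup>2\<close> span a submodule, hence they form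
  a basis \<open>w\<^sub>0, \<dots>, w\<^sub>d\<close> of weights \<open>\<nu>, \<nu> - 4, \<dots>, \<nu> - 4 d\<close>, called a lowering chain here, and the module is
  determined up to isomorphism by \<open>d\<close>, \<open>\<nu>\<close> and \<open>c\<close> (\<open>lowering_chain_iso\<close>).
  Since \<open>F\<^sup>2 E\<^sup>2\<close> kills \<open>w\<^sub>0\<close> and \<open>E\<^sup>2 F\<^sup>2\<close> kills \<open>w\<^sub>d\<close>, the two products above vanish at \<open>\<theta> = \<nu>\<close> and
  \<open>\<theta> = \<nu> - 4 d\<close>, respectively. Choosing a factor of each leaves four systems of equations, each with one
  solution \<open>(\<nu>, c)\<close> (\<open>lowering_chain_parameters\<close>).

  The four modules of the theorem are lowering chains with these four parameter pairs
  (\<open>lowering_chain_L_part\<close>). They are irreducible because \<open>E\<^sup>2 F\<^sup>2\<close> multiplies every \<open>w\<^sub>i\<close> with \<open>i < d\<close>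
  by a nonzero number (\<open>lowering_chain_irreducible\<close>).
\<close>

section \<open>Independent families and eigenvectors\<close>

locale complex_space = vector_space scale
  for scale :: "complex \<Rightarrow> 'b::ab_group_add \<Rightarrow> 'b"
begin

text \<open>Independence of a family rather than of a set of vectors, so that relations between the iterates \<open>T\<^sup>i u\<close>
  of an operator are covered even when some of them coincide.\<close>

definition indep_family :: "'i set \<Rightarrow> ('i \<Rightarrow> 'b) \<Rightarrow> bool" where
  "indep_family I w \<longleftrightarrow> (\<forall>a. (\<Sum>i\<in>I. scale (a i) (w i)) = 0 \<longrightarrow> (\<forall>i\<in>I. a i = 0))"

lemma indep_familyD:
  "indep_family I w \<Longrightarrow> (\<Sum>i\<in>I. scale (a i) (w i)) = 0 \<Longrightarrow> i \<in> I \<Longrightarrow> a i = 0"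
  by (auto simp: indep_family_def)

lemma indep_family_independent:
  assumes fin: "finite I" and ind: "indep_family I w"
  shows "inj_on w I" "independent (w ` I)"
proof -
  show inj: "inj_on w I"
  proof (rule inj_onI, rule ccontr)
    fix i j assume ij: "i \<in> I" "j \<in> I" "w i = w j" "i \<noteq> j"
    let ?a = "\<lambda>k. (if k = i then 1 else 0) - (if k = j then 1 else 0) :: complex"
    have "(\<Sum>k\<in>I. scale (?a k) (w k)) =
        (\<Sum>k\<in>I. if k = i then w k else 0) - (\<Sum>k\<in>I. if k = j then w k else 0)"
      unfolding sum_subtractf[symmetric] by (intro sum.cong) (auto simp: scale_left_diff_distrib)
    also have "\<dots> = 0" using ij fin by simp
    finally have "?a i = 0" using indep_familyD[OF ind, of ?a i] ij by blast
    with ij show False by simp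
  qed
  show "independent (w ` I)"
  proof (rule independent_if_scalars_zero)
    show "finite (w ` I)" using fin by simp
    fix f x assume "(\<Sum>x\<in>w ` I. scale (f x) x) = 0" "x \<in> w ` I"
    then show "f x = 0"
      using indep_familyD[OF ind, of "f \<circ> w"] by (auto simp: sum.reindex[OF inj])
  qed
qed

lemma indep_family_card_le:
  assumes "finite I" "indep_family I w" "w ` I \<subseteq> span B" "finite B"
  shows "card I \<le> card B"
  using independent_span_bound[OF assms(4) indep_family_independent(2)[OF assms(1,2)] assms(3)]
    card_image[OF indep_family_independent(1)[OF assms(1,2)]] by simp

lemma span_image_sumE:
  assumes "x \<in> span (w ` I)" "finite I"
  obtains a where "x = (\<Sum>i\<in>I. scale (a i) (w i))"
proof -
  have "\<exists>a. x = (\<Sum>i\<in>I. scale (a i) (w i))"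
    using assms(1)
  proof (induction rule: span_induct_alt)
    case base
    show ?case by (intro exI[of _ "\<lambda>_. 0"]) simp
  next
    case (step c y z)
    then obtain j a where j: "y = w j" "j \<in> I" and a: "z = (\<Sum>i\<in>I. scale (a i) (w i))" by auto
    have "(\<Sum>i\<in>I. scale ((if i = j then c else 0) + a i) (w i)) =
        (\<Sum>i\<in>I. if i = j then scale c (w i) else 0) + z"
      unfolding a sum.distrib[symmetric] by (intro sum.cong) (auto simp: scale_left_distrib)
    then show ?case using j assms(2) by (intro exI[of _ "\<lambda>i. (if i = j then c else 0) + a i"]) simp
  qed
  with that show thesis by blast
qed

text \<open>A linear relation, acted on by \<open>T\<close> and reduced by \<open>\<mu> j\<close> times itself, loses the term of
  index \<open>j\<close> and keeps nonzero multiples of all other coefficients.\<close>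

lemma eigenvectors_indep_family:
  assumes "finite I" and W: "subspace W"
    and add: "\<And>u v. u \<in> W \<Longrightarrow> v \<in> W \<Longrightarrow> T (u + v) = T u + T v"
    and hom: "\<And>c v. v \<in> W \<Longrightarrow> T (scale c v) = scale c (T v)"
    and w: "\<And>i. i \<in> I \<Longrightarrow> w i \<in> W" "\<And>i. i \<in> I \<Longrightarrow> w i \<noteq> 0"
      "\<And>i. i \<in> I \<Longrightarrow> T (w i) = scale (\<mu> i) (w i)"
    and inj: "inj_on \<mu> I"
  shows "indep_family I w"
  using assms(1) w inj
proof (induction I)
  case empty
  show ?case by (simp add: indep_family_def)
next
  case (insert j I)
  then have IH: "indep_family I w" by simp
  have T0: "T 0 = 0" using hom[of 0 0] W by (simp add: subspace_0)
  show ?case unfolding indep_family_def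
  proof (intro allI impI)
    fix a assume a: "(\<Sum>i\<in>insert j I. scale (a i) (w i)) = 0"
    have inW: "(\<Sum>i\<in>J. scale (a i) (w i)) \<in> W" if "J \<subseteq> insert j I" for J
      using that insert.prems W by (intro subspace_sum subspace_scale) auto
    have T: "T (\<Sum>i\<in>J. scale (a i) (w i)) = (\<Sum>i\<in>J. scale (a i * \<mu> i) (w i))"
      if "finite J" "J \<subseteq> insert j I" for J
      using that
    proof (induction J)
      case (insert k J)
      then have "w k \<in> W" "T (w k) = scale (\<mu> k) (w k)"
        using \<open>\<And>i. i \<in> insert j I \<Longrightarrow> w i \<in> W\<close>
          \<open>\<And>i. i \<in> insert j I \<Longrightarrow> T (w i) = scale (\<mu> i) (w i)\<close> by auto
      with insert inW[of J] W show ?case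
        by (simp add: add hom subspace_scale)
    qed (simp add: T0)
    have "(\<Sum>i\<in>insert j I. scale (a i * (\<mu> i - \<mu> j)) (w i)) =
        T (\<Sum>i\<in>insert j I. scale (a i) (w i)) - scale (\<mu> j) (\<Sum>i\<in>insert j I. scale (a i) (w i))"
      using insert.hyps
      by (subst T) (auto simp: scale_sum_right sum_subtractf[symmetric] algebra_simps
          simp del: sum.insert intro!: sum.cong)
    then have "(\<Sum>i\<in>I. scale (a i * (\<mu> i - \<mu> j)) (w i)) = 0"
      using a insert.hyps by (simp add: T0)
    then have "a i * (\<mu> i - \<mu> j) = 0" if "i \<in> I" for i
      using indep_familyD[OF IH, of "\<lambda>i. a i * (\<mu> i - \<mu> j)"] that by blast
    moreover have "\<mu> i \<noteq> \<mu> j" if "i \<in> I" for i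
      using insert.prems(4) insert.hyps that by (auto simp: inj_on_def)
    ultimately have aI: "a i = 0" if "i \<in> I" for i using that by simp
    then have "scale (a j) (w j) = 0" using a insert.hyps by simp
    then show "\<forall>i\<in>insert j I. a i = 0" using aI insert.prems(2)[of j] by auto
  qed
qed

end

text \<open>A polynomial that kills a nonzero vector has a linear factor; the complementary factor
  either produces an eigenvector or kills the vector itself.\<close>

lemma annihilating_poly_eigenvector:
  fixes s :: "complex \<Rightarrow> 'v::ab_group_add \<Rightarrow> 'v"
  assumes "vector_space s" and W: "module.subspace s W"
    and T: "\<And>v. v \<in> W \<Longrightarrow> T v \<in> W"
    and add: "\<And>u v. u \<in> W \<Longrightarrow> v \<in> W \<Longrightarrow> T (u + v) = T u + T v"
    and hom: "\<And>c v. v \<in> W \<Longrightarrow> T (s c v) = s c (T v)"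
    and u: "u \<in> W" "u \<noteq> 0"
  shows "p \<noteq> 0 \<Longrightarrow> degree p \<le> n \<Longrightarrow> (\<Sum>i\<le>n. s (coeff p i) ((T ^^ i) u)) = 0 \<Longrightarrow>
    \<exists>\<theta>. \<exists>v\<in>W. v \<noteq> 0 \<and> T v = s \<theta> v"
proof (induction n arbitrary: p)
  interpret complex_space s using assms(1) by (rule complex_space.intro)
  case 0
  then have "coeff p 0 \<noteq> 0" by (metis le_zero_eq leading_coeff_0_iff)
  with 0 u show ?case by simp
next
  interpret complex_space s using assms(1) by (rule complex_space.intro)
  case (Suc n)
  have Tu: "(T ^^ i) u \<in> W" for i by (induction i) (auto simp: u T)
  have T0: "T 0 = 0" using hom[of 0 0] W by (simp add: subspace_0)
  show ?case
  proof (cases "degree p = 0")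
    case True
    then have p0: "coeff p i = 0" if "i \<noteq> 0" for i
      using that by (intro coeff_eq_0) simp
    have "(\<Sum>i\<le>Suc n. s (coeff p i) ((T ^^ i) u)) = s (coeff p 0) u"
      by (subst sum.atMost_Suc_shift) (simp add: p0)
    moreover have "coeff p 0 \<noteq> 0" using True Suc.prems(1) by (metis leading_coeff_0_iff)
    ultimately show ?thesis using Suc.prems(3) u by simp
  next
    case False
    then have "\<not> constant (poly p)" by (simp add: constant_degree)
    then obtain r where "poly p r = 0" using fundamental_theorem_of_algebra by blast
    then obtain q where q: "p = [:- r, 1:] * q" by (auto simp: poly_eq_0_iff_dvd)
    with Suc.prems(1) have "q \<noteq> 0" by auto
    then have "degree p = Suc (degree q)" unfolding q by (subst degree_mult_eq) auto
    then have dq: "degree q \<le> n" using Suc.prems(2) by simp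
    define y where "y = (\<Sum>i\<le>n. s (coeff q i) ((T ^^ i) u))"
    have sumW: "(\<Sum>i\<in>A. s (coeff q i) ((T ^^ i) u)) \<in> W" for A
      by (intro subspace_sum subspace_scale W Tu)
    have T_sum: "T (\<Sum>i\<le>m. s (coeff q i) ((T ^^ i) u)) = (\<Sum>i\<le>m. s (coeff q i) ((T ^^ Suc i) u))" for m
      by (induction m) (use Tu[of "Suc _"] in \<open>simp_all add: add hom Tu sumW W u T subspace_scale\<close>)
    have cp: "coeff p i = (case i of 0 \<Rightarrow> 0 | Suc j \<Rightarrow> coeff q j) - r * coeff q i" for i
      by (simp add: q coeff_pCons)
    have "(\<Sum>i\<le>Suc n. s (coeff p i) ((T ^^ i) u)) =
        (\<Sum>i\<le>Suc n. s (case i of 0 \<Rightarrow> 0 | Suc j \<Rightarrow> coeff q j) ((T ^^ i) u)) -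
        (\<Sum>i\<le>Suc n. s (r * coeff q i) ((T ^^ i) u))"
      by (simp add: cp scale_left_diff_distrib sum_subtractf del: sum.atMost_Suc)
    also have "(\<Sum>i\<le>Suc n. s (case i of 0 \<Rightarrow> 0 | Suc j \<Rightarrow> coeff q j) ((T ^^ i) u)) = T y"
      unfolding y_def T_sum by (subst sum.atMost_Suc_shift) simp
    also have "(\<Sum>i\<le>Suc n. s (r * coeff q i) ((T ^^ i) u)) = s r y"
      using dq by (simp add: y_def scale_sum_right coeff_eq_0)
    finally have Ty: "T y = s r y" using Suc.prems(3) by simp
    show ?thesis
    proof (cases "y = 0")
      case True
      then show ?thesis using Suc.IH[OF \<open>q \<noteq> 0\<close> dq] by (simp add: y_def)
    next
      case False
      then show ?thesis using Ty sumW[of "{..n}"] by (auto simp: y_def)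
    qed
  qed
qed

lemma eigenvector_exists:
  fixes s :: "complex \<Rightarrow> 'v::ab_group_add \<Rightarrow> 'v"
  assumes "vector_space s" and W: "module.subspace s W"
    and fin: "finite B" "W \<subseteq> module.span s B" and "W \<noteq> {0}"
    and T: "\<And>v. v \<in> W \<Longrightarrow> T v \<in> W"
    and add: "\<And>u v. u \<in> W \<Longrightarrow> v \<in> W \<Longrightarrow> T (u + v) = T u + T v"
    and hom: "\<And>c v. v \<in> W \<Longrightarrow> T (s c v) = s c (T v)"
  shows "\<exists>\<theta>. \<exists>v\<in>W. v \<noteq> 0 \<and> T v = s \<theta> v"
proof -
  interpret complex_space s using assms(1) by (rule complex_space.intro)
  obtain u where u: "u \<in> W" "u \<noteq> 0" using \<open>W \<noteq> {0}\<close> subspace_0[OF W] by auto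
  have Tu: "(T ^^ i) u \<in> W" for i by (induction i) (auto simp: u T)
  let ?n = "card B"
  have "\<not> indep_family {..?n} (\<lambda>i. (T ^^ i) u)"
    using indep_family_card_le[of "{..?n}" "\<lambda>i. (T ^^ i) u" B] Tu fin by auto
  then obtain a j where a: "(\<Sum>i\<le>?n. s (a i) ((T ^^ i) u)) = 0" "j \<le> ?n" "a j \<noteq> 0"
    by (auto simp: indep_family_def)
  define p where "p = (\<Sum>i\<le>?n. monom (a i) i)"
  have cp: "coeff p i = (if i \<le> ?n then a i else 0)" for i
    by (simp add: p_def coeff_sum)
  show ?thesis
  proof (rule annihilating_poly_eigenvector[OF assms(1) W T add hom u])
    show "p \<noteq> 0" using a cp[of j] by auto
    show "degree p \<le> ?n" by (rule degree_le) (simp add: cp)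
    show "(\<Sum>i\<le>?n. s (coeff p i) ((T ^^ i) u)) = 0" using a by (simp add: cp)
  qed
qed

section \<open>The even subalgebra of \<open>U(sl\<^sub>2)\<close>\<close>

text \<open>The Casimir element is central in the whole of \<open>U(sl\<^sub>2)\<close> and even, so it serves as a generator of the even
  subalgebra in place of \<open>F E\<close>, with which \<open>E\<^sup>2\<close> and \<open>F\<^sup>2\<close> do not commute.\<close>

definition casimir :: usl2 where
  "casimir = usl2_scale 4 (uF * uE) + uH * uH + usl2_scale 2 uH"

lemma usl2_scale_numerals:
  "usl2_scale 2 x = x + x" "usl2_scale 4 x = x + x + x + x" "usl2_scale (- 2) x = - x - x"
proof -
  show 2: "usl2_scale 2 x = x + x" for x
    using usl2.scale_left_distrib[of 1 1 x] by simp
  show "usl2_scale 4 x = x + x + x + x"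
    using usl2.scale_left_distrib[of 2 2 x] by (simp add: 2 add.assoc)
  show "usl2_scale (- 2) x = - x - x"
    by (simp add: 2)
qed

text \<open>Rewriting with these rules sorts every word into the order \<open>F\<close>, \<open>H\<close>, \<open>E\<close>, which decides equations in
  \<open>U(sl\<^sub>2)\<close>; the last three are the forms for right-associated products.\<close>

lemma normal_order:
  "uE * uH = uH * uE - uE - uE" "uH * uF = uF * uH - uF - uF" "uE * uF = uF * uE + uH"
  "uE * (uH * x) = uH * (uE * x) - uE * x - uE * x"
  "uH * (uF * x) = uF * (uH * x) - uF * x - uF * x"
  "uE * (uF * x) = uF * (uE * x) + uH * x"
proof -
  show *: "uE * uH = uH * uE - uE - uE" "uH * uF = uF * uH - uF - uF" "uE * uF = uF * uE + uH"
    using usl2_relations by (simp_all add: usl2_scale_numerals algebra_simps)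
  show "uE * (uH * x) = uH * (uE * x) - uE * x - uE * x"
    "uH * (uF * x) = uF * (uH * x) - uF * x - uF * x"
    "uE * (uF * x) = uF * (uE * x) + uH * x"
    using arg_cong[OF *(1), of "\<lambda>y. y * x"] arg_cong[OF *(2), of "\<lambda>y. y * x"]
      arg_cong[OF *(3), of "\<lambda>y. y * x"] by (simp_all add: algebra_simps)
qed

lemma casimir_commutes:
  "casimir * uE = uE * casimir" "casimir * uF = uF * casimir" "casimir * uH = uH * casimir"
  by (simp_all add: casimir_def usl2_scale_numerals distrib_left distrib_right mult.assoc normal_order
      left_diff_distrib right_diff_distrib)

text \<open>Both products lie in the commutative algebra generated by \<open>H\<close> and \<open>E F\<close>, so they act by scalars on common
  eigenvectors.\<close>

lemma EEFF: "(uE * uE) * (uF * uF) = (uE * uF) * (uE * uF + uH - usl2_scale 2 1)"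
  and FFEE: "(uF * uF) * (uE * uE) = (uF * uE) * (uF * uE - uH - usl2_scale 2 1)"
  unfolding right_diff_distrib usl2_scale_mult_right mult_1_right
  by (simp_all add: usl2_scale_numerals distrib_left distrib_right mult.assoc normal_order
      left_diff_distrib right_diff_distrib)

lemma even_word_in_usl2_even:
  "even (sum_list (map gen_deg gs)) \<Longrightarrow> prod_list (map usl2_gen gs) \<in> usl2_even"
  unfolding usl2_even_def
  by (rule usl2.span_base) (auto simp: usl2_hom_def intro!: usl2.span_base elim!: evenE)

lemma usl2_even_gens:
  "uE * uE \<in> usl2_even" "uF * uF \<in> usl2_even" "uH \<in> usl2_even" "uE * uF \<in> usl2_even" "uF * uE \<in> usl2_even"
  using even_word_in_usl2_even[of "[GE, GE]"] even_word_in_usl2_even[of "[GF, GF]"]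
    even_word_in_usl2_even[of "[GH]"] even_word_in_usl2_even[of "[GE, GF]"]
    even_word_in_usl2_even[of "[GF, GE]"] by simp_all

lemma usl2_even_add: "x \<in> usl2_even \<Longrightarrow> y \<in> usl2_even \<Longrightarrow> x + y \<in> usl2_even"
  and usl2_even_diff: "x \<in> usl2_even \<Longrightarrow> y \<in> usl2_even \<Longrightarrow> x - y \<in> usl2_even"
  and usl2_even_scale: "x \<in> usl2_even \<Longrightarrow> usl2_scale c x \<in> usl2_even"
  using usl2_even_subalgebra(1) by (simp_all add: usl2.subspace_add usl2.subspace_diff usl2.subspace_scale)

lemma casimir_even: "casimir \<in> usl2_even"
  unfolding casimir_def
  by (intro usl2_even_add usl2_even_scale usl2_even_subalgebra(3) usl2_even_gens)

text \<open>Reading a word from left to right, the prefixes of even degree lie in the subalgebra \<open>A\<close>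
  generated by \<open>E\<^sup>2\<close>, \<open>F\<^sup>2\<close>, \<open>H\<close> and the Casimir element, and those of odd degree in \<open>A E + A F\<close>; a letter \<open>H\<close> can be moved
  across \<open>E\<close> and \<open>F\<close> into \<open>A\<close>.\<close>

lemma usl2_even_induct [consumes 1, case_names one EE FF H casimir add scale mult]:
  assumes "x \<in> usl2_even"
    and P1: "P 1" and PEE: "P (uE * uE)" and PFF: "P (uF * uF)" and PH: "P uH" and PC: "P casimir"
    and Padd: "\<And>x y. x \<in> usl2_even \<Longrightarrow> y \<in> usl2_even \<Longrightarrow> P x \<Longrightarrow> P y \<Longrightarrow> P (x + y)"
    and Pscale: "\<And>c x. x \<in> usl2_even \<Longrightarrow> P x \<Longrightarrow> P (usl2_scale c x)"
    and Pmult: "\<And>x y. x \<in> usl2_even \<Longrightarrow> y \<in> usl2_even \<Longrightarrow> P x \<Longrightarrow> P y \<Longrightarrow> P (x * y)"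
  shows "P x"
proof -
  define A where "A = {x \<in> usl2_even. P x}"
  have A_mult: "x * y \<in> A" if "x \<in> A" "y \<in> A" for x y
    using that by (simp add: A_def usl2_even_subalgebra(3) Pmult)
  have A_add: "x + y \<in> A" if "x \<in> A" "y \<in> A" for x y
    using that by (simp add: A_def usl2_even_add Padd)
  have A_scale: "usl2_scale c x \<in> A" if "x \<in> A" for c x
    using that by (simp add: A_def usl2_even_scale Pscale)
  have A_diff: "x - y \<in> A" if "x \<in> A" "y \<in> A" for x y
    using A_add[OF that(1) A_scale[OF that(2), of "- 1"]] by simp
  have A1: "1 \<in> A" and AEE: "uE * uE \<in> A" and AFF: "uF * uF \<in> A" and AH: "uH \<in> A" and AC: "casimir \<in> A"
    by (simp_all add: A_def usl2_even_subalgebra(2) usl2_even_gens casimir_even P1 PEE PFF PH PC)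
  have "uF * uE = usl2_scale (1 / 4) (casimir - uH * uH - usl2_scale 2 uH)"
    by (simp add: casimir_def)
  then have AFE: "uF * uE \<in> A" by (simp only: A_scale A_diff A_mult AH AC)
  then have AEF: "uE * uF \<in> A" unfolding normal_order(3) using AH by (rule A_add)
  have A0: "0 \<in> A" using A_scale[OF A1, of 0] by simp
  have word: "(even (sum_list (map gen_deg gs)) \<longrightarrow> prod_list (map usl2_gen gs) \<in> A) \<and>
    (odd (sum_list (map gen_deg gs)) \<longrightarrow> (\<exists>a\<in>A. \<exists>b\<in>A. prod_list (map usl2_gen gs) = a * uE + b * uF))" for gs
  proof (induction gs rule: rev_induct)
    case Nil
    show ?case by (simp add: A1)
  next
    case (snoc g gs)
    let ?w = "prod_list (map usl2_gen gs)"
    show ?case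
    proof (cases "even (sum_list (map gen_deg gs))")
      case True
      with snoc have w: "?w \<in> A" by simp
      show ?thesis
      proof (cases g)
        case GE
        then have "prod_list (map usl2_gen (gs @ [g])) = ?w * uE + 0 * uF" by simp
        moreover have "odd (sum_list (map gen_deg (gs @ [g])))" using True GE by simp
        ultimately show ?thesis using w A0 by blast
      next
        case GF
        then have "prod_list (map usl2_gen (gs @ [g])) = 0 * uE + ?w * uF" by simp
        moreover have "odd (sum_list (map gen_deg (gs @ [g])))" using True GF by simp
        ultimately show ?thesis using w A0 by blast
      next
        case GH
        with w True show ?thesis by (simp add: A_mult AH)
      qed
    next
      case False
      with snoc obtain a b where ab: "a \<in> A" "b \<in> A" "?w = a * uE + b * uF" by auto
      show ?thesis
      proof (cases g)
        case GE
        have "?w * uE = a * (uE * uE) + b * (uF * uE)" by (simp add: ab algebra_simps)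
        also have "\<dots> \<in> A" by (rule A_add[OF A_mult[OF ab(1) AEE] A_mult[OF ab(2) AFE]])
        finally show ?thesis using False GE by simp
      next
        case GF
        have "?w * uF = a * (uE * uF) + b * (uF * uF)" by (simp add: ab algebra_simps)
        also have "\<dots> \<in> A" by (rule A_add[OF A_mult[OF ab(1) AEF] A_mult[OF ab(2) AFF]])
        finally show ?thesis using False GF by simp
      next
        case GH
        have "?w * uH = (a * (uH - usl2_scale 2 1)) * uE + (b * (uH + usl2_scale 2 1)) * uF"
          unfolding ab right_diff_distrib left_diff_distrib distrib_left distrib_right
            usl2_scale_mult_left usl2_scale_mult_right mult_1_right mult.assoc normal_order usl2_scale_numerals
          by simp
        moreover have "a * (uH - usl2_scale 2 1) \<in> A" "b * (uH + usl2_scale 2 1) \<in> A"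
          using ab AH A1 by (intro A_mult A_add A_diff A_scale; simp)+
        ultimately show ?thesis using False GH by auto
      qed
    qed
  qed
  have sub: "usl2.subspace A" by (rule usl2.subspaceI) (auto simp: A0 A_add A_scale)
  have "usl2_hom (2 * n) \<subseteq> A" for n
    unfolding usl2_hom_def by (rule usl2.span_minimal[OF _ sub]) (use word in auto)
  then have "usl2_even \<subseteq> A"
    unfolding usl2_even_def by (intro usl2.span_minimal[OF _ sub]) auto
  with assms(1) show "P x" by (auto simp: A_def)
qed

section \<open>Weight vectors in modules over the even subalgebra\<close>

locale even_module =
  fixes M :: "'v::ab_group_add umod"
  assumes umod: "is_umod usl2_even M"
begin

sublocale complex_space "umod.smult M"
  using umod by (auto simp: is_umod_def intro: complex_space.intro)

lemma subspace_carrier: "subspace (umod.carrier M)"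
  using umod by (simp add: is_umod_def)

lemma act_closed: "a \<in> usl2_even \<Longrightarrow> v \<in> umod.carrier M \<Longrightarrow> act M a v \<in> umod.carrier M"
  and act_add: "a \<in> usl2_even \<Longrightarrow> v \<in> umod.carrier M \<Longrightarrow> w \<in> umod.carrier M \<Longrightarrow>
    act M a (v + w) = act M a v + act M a w"
  and act_scale: "a \<in> usl2_even \<Longrightarrow> v \<in> umod.carrier M \<Longrightarrow>
    act M a (umod.smult M c v) = umod.smult M c (act M a v)"
  and act_plus: "a \<in> usl2_even \<Longrightarrow> b \<in> usl2_even \<Longrightarrow> v \<in> umod.carrier M \<Longrightarrow>
    act M (a + b) v = act M a v + act M b v"
  and act_usl2_scale: "a \<in> usl2_even \<Longrightarrow> v \<in> umod.carrier M \<Longrightarrow>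
    act M (usl2_scale c a) v = umod.smult M c (act M a v)"
  and act_mult: "a \<in> usl2_even \<Longrightarrow> b \<in> usl2_even \<Longrightarrow> v \<in> umod.carrier M \<Longrightarrow>
    act M (a * b) v = act M a (act M b v)"
  and act_one: "v \<in> umod.carrier M \<Longrightarrow> act M 1 v = v"
  using umod unfolding is_umod_def by blast+

lemma act_diff: "a \<in> usl2_even \<Longrightarrow> b \<in> usl2_even \<Longrightarrow> v \<in> umod.carrier M \<Longrightarrow>
    act M (a - b) v = act M a v - act M b v"
  using act_plus[of "a - b" b v] by (simp add: usl2_even_diff)

lemma act_zero: "a \<in> usl2_even \<Longrightarrow> act M a 0 = 0"
  using act_scale[of a 0 0] subspace_0[OF subspace_carrier] by simp

lemma act_sum:
  assumes "a \<in> usl2_even" "finite I" "\<And>i. i \<in> I \<Longrightarrow> w i \<in> umod.carrier M"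
  shows "act M a (\<Sum>i\<in>I. umod.smult M (k i) (w i)) = (\<Sum>i\<in>I. umod.smult M (k i) (act M a (w i)))"
  using assms(2,3)
proof (induction I)
  case (insert i I)
  have "(\<Sum>i\<in>I. umod.smult M (k i) (w i)) \<in> umod.carrier M"
    using insert by (intro subspace_sum subspace_scale subspace_carrier) auto
  with insert assms(1) show ?case
    by (simp add: act_add act_scale subspace_scale[OF subspace_carrier])
qed (simp add: act_zero assms(1))

text \<open>Reduces invariance under the even subalgebra to the action of its four generators on spanning vectors.\<close>

lemma span_invariant:
  assumes X: "X \<subseteq> umod.carrier M"
    and gens: "\<And>a x. a \<in> {uE * uE, uF * uF, uH, casimir} \<Longrightarrow> x \<in> X \<Longrightarrow> act M a x \<in> span X"
    and a: "a \<in> usl2_even" and v: "v \<in> span X"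
  shows "act M a v \<in> span X"
proof -
  have sub: "span X \<subseteq> umod.carrier M" by (rule span_minimal[OF X subspace_carrier])
  have lin: "act M a v \<in> span X"
    if a: "a \<in> usl2_even" "\<And>x. x \<in> X \<Longrightarrow> act M a x \<in> span X" and v: "v \<in> span X" for a v
  proof -
    have "v \<in> span X \<and> act M a v \<in> span X"
      using v
    proof (induction rule: span_induct_alt)
      case base
      show ?case using a by (simp add: act_zero span_zero)
    next
      case (step c x y)
      moreover have "x \<in> umod.carrier M" "y \<in> umod.carrier M" using step X sub by auto
      ultimately show ?case
        using a by (simp add: act_add act_scale subspace_scale[OF subspace_carrier] span_add span_scale span_base)
    qed
    then show ?thesis by simp
  qed
  from a have "\<forall>v\<in>span X. act M a v \<in> span X"
  proof (induction rule: usl2_even_induct)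
    case one
    show ?case using sub by (auto simp: act_one)
  next
    case (add x y)
    then show ?case using sub by (simp add: act_plus span_add subset_iff)
  next
    case (scale c x)
    then show ?case using sub by (simp add: act_usl2_scale span_scale subset_iff)
  next
    case (mult x y)
    then show ?case using sub by (simp add: act_mult subset_iff)
  qed (use lin usl2_even_gens casimir_even gens in auto)
  with v show ?thesis by blast
qed

text \<open>The Casimir eigenvalue \<open>c\<close> is recorded because \<open>\<theta>\<close> alone does not determine the scalars by which
  \<open>F\<^sup>2 E\<^sup>2\<close> and \<open>E\<^sup>2 F\<^sup>2\<close> act.\<close>

definition weight_vector :: "complex \<Rightarrow> complex \<Rightarrow> 'v \<Rightarrow> bool" where
  "weight_vector \<theta> c v \<longleftrightarrow> v \<in> umod.carrier M \<and> act M uH v = umod.smult M \<theta> v \<and>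
     act M casimir v = umod.smult M c v"

lemma weight_vector_FE:
  assumes "weight_vector \<theta> c v"
  shows "act M (uF * uE) v = umod.smult M ((c - \<theta>\<^sup>2 - 2 * \<theta>) / 4) v"
proof -
  have v: "v \<in> umod.carrier M" "act M uH v = umod.smult M \<theta> v" "act M casimir v = umod.smult M c v"
    using assms by (auto simp: weight_vector_def)
  have eq: "uF * uE = usl2_scale (1 / 4) (casimir - uH * uH - usl2_scale 2 uH)"
    by (simp add: casimir_def)
  have "act M (uF * uE) v = umod.smult M (1 / 4) (umod.smult M c v - umod.smult M (\<theta> * \<theta>) v - umod.smult M (2 * \<theta>) v)"
    unfolding eq using v
    by (simp add: act_usl2_scale act_diff act_mult act_scale usl2_even_diff usl2_even_scale
        usl2_even_subalgebra(3) usl2_even_gens casimir_even)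
  also have "\<dots> = umod.smult M (1 / 4 * (c - \<theta> * \<theta> - 2 * \<theta>)) v"
    by (simp only: scale_left_diff_distrib[symmetric] scale_scale)
  also have "1 / 4 * (c - \<theta> * \<theta> - 2 * \<theta>) = (c - \<theta>\<^sup>2 - 2 * \<theta>) / 4"
    by (simp add: power2_eq_square)
  finally show ?thesis .
qed

lemma weight_vector_EF:
  assumes "weight_vector \<theta> c v"
  shows "act M (uE * uF) v = umod.smult M ((c - \<theta>\<^sup>2 + 2 * \<theta>) / 4) v"
proof -
  have v: "v \<in> umod.carrier M" "act M uH v = umod.smult M \<theta> v"
    using assms by (auto simp: weight_vector_def)
  have "act M (uE * uF) v = umod.smult M ((c - \<theta>\<^sup>2 - 2 * \<theta>) / 4) v + umod.smult M \<theta> v"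
    unfolding normal_order(3) using v weight_vector_FE[OF assms] by (simp add: act_plus usl2_even_gens)
  also have "\<dots> = umod.smult M ((c - \<theta>\<^sup>2 - 2 * \<theta>) / 4 + \<theta>) v"
    by (simp only: scale_left_distrib)
  also have "(c - \<theta>\<^sup>2 - 2 * \<theta>) / 4 + \<theta> = (c - \<theta>\<^sup>2 + 2 * \<theta>) / 4"
    by (simp add: field_simps)
  finally show ?thesis .
qed

lemma weight_vector_FFEE:
  assumes "weight_vector \<theta> c v"
  shows "act M (uF * uF) (act M (uE * uE) v) =
    umod.smult M ((c - \<theta>\<^sup>2 - 2 * \<theta>) * (c - \<theta>\<^sup>2 - 6 * \<theta> - 8) / 16) v"
proof -
  have v: "v \<in> umod.carrier M" "act M uH v = umod.smult M \<theta> v"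
    using assms by (auto simp: weight_vector_def)
  let ?x = "(c - \<theta>\<^sup>2 - 2 * \<theta>) / 4"
  have even: "uF * uE \<in> usl2_even" "uH \<in> usl2_even" "1 \<in> usl2_even" "usl2_scale 2 1 \<in> usl2_even"
    "uF * uE - uH \<in> usl2_even" "uF * uE - uH - usl2_scale 2 1 \<in> usl2_even"
    by (intro usl2_even_gens usl2_even_subalgebra(2) usl2_even_scale usl2_even_diff usl2_even_add)+
  have "act M (uF * uF) (act M (uE * uE) v) = act M ((uF * uF) * (uE * uE)) v"
    using v by (simp add: act_mult usl2_even_gens)
  also have "\<dots> = act M (uF * uE) (act M (uF * uE - uH - usl2_scale 2 1) v)"
    unfolding FFEE using v even by (simp only: act_mult)
  also have "act M (uF * uE - uH - usl2_scale 2 1) v =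
      umod.smult M ?x v - umod.smult M \<theta> v - umod.smult M 2 v"
    using v even weight_vector_FE[OF assms]
    by (simp only: act_usl2_scale act_diff act_plus act_one)
  also have "\<dots> = umod.smult M (?x - \<theta> - 2) v"
    by (simp only: scale_left_diff_distrib scale_left_distrib)
  also have "act M (uF * uE) \<dots> = umod.smult M ((?x - \<theta> - 2) * ?x) v"
    using v even by (simp only: act_scale weight_vector_FE[OF assms] scale_scale)
  also have "(?x - \<theta> - 2) * ?x = (c - \<theta>\<^sup>2 - 2 * \<theta>) * (c - \<theta>\<^sup>2 - 6 * \<theta> - 8) / 16"
    by (simp add: field_simps)
  finally show ?thesis .
qed

lemma weight_vector_EEFF:
  assumes "weight_vector \<theta> c v"
  shows "act M (uE * uE) (act M (uF * uF) v) =
    umod.smult M ((c - \<theta>\<^sup>2 + 2 * \<theta>) * (c - \<theta>\<^sup>2 + 6 * \<theta> - 8) / 16) v"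
proof -
  have v: "v \<in> umod.carrier M" "act M uH v = umod.smult M \<theta> v"
    using assms by (auto simp: weight_vector_def)
  let ?x = "(c - \<theta>\<^sup>2 + 2 * \<theta>) / 4"
  have even: "uE * uF \<in> usl2_even" "uH \<in> usl2_even" "1 \<in> usl2_even" "usl2_scale 2 1 \<in> usl2_even"
    "uE * uF + uH \<in> usl2_even" "uE * uF + uH - usl2_scale 2 1 \<in> usl2_even"
    by (intro usl2_even_gens usl2_even_subalgebra(2) usl2_even_scale usl2_even_diff usl2_even_add)+
  have "act M (uE * uE) (act M (uF * uF) v) = act M ((uE * uE) * (uF * uF)) v"
    using v by (simp add: act_mult usl2_even_gens)
  also have "\<dots> = act M (uE * uF) (act M (uE * uF + uH - usl2_scale 2 1) v)"
    unfolding EEFF using v even by (simp only: act_mult)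
  also have "act M (uE * uF + uH - usl2_scale 2 1) v =
      umod.smult M ?x v + umod.smult M \<theta> v - umod.smult M 2 v"
    using v even weight_vector_EF[OF assms]
    by (simp only: act_usl2_scale act_diff act_plus act_one)
  also have "\<dots> = umod.smult M (?x + \<theta> - 2) v"
    by (simp only: scale_left_diff_distrib scale_left_distrib)
  also have "act M (uE * uF) \<dots> = umod.smult M ((?x + \<theta> - 2) * ?x) v"
    using v even by (simp only: act_scale weight_vector_EF[OF assms] scale_scale)
  also have "(?x + \<theta> - 2) * ?x = (c - \<theta>\<^sup>2 + 2 * \<theta>) * (c - \<theta>\<^sup>2 + 6 * \<theta> - 8) / 16"
    by (simp add: field_simps)
  finally show ?thesis .
qed

lemma weight_vector_FF:
  assumes "weight_vector \<theta> c v"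
  shows "weight_vector (\<theta> - 4) c (act M (uF * uF) v)"
proof -
  have v: "v \<in> umod.carrier M" "act M uH v = umod.smult M \<theta> v" "act M casimir v = umod.smult M c v"
    using assms by (auto simp: weight_vector_def)
  have HFF: "uH * (uF * uF) = (uF * uF) * uH - usl2_scale 4 (uF * uF)"
    by (simp add: usl2_scale_numerals mult.assoc normal_order right_diff_distrib)
  have CFF: "casimir * (uF * uF) = (uF * uF) * casimir"
    by (metis casimir_commutes(2) mult.assoc)
  have "act M uH (act M (uF * uF) v) = act M (uH * (uF * uF)) v"
    "act M casimir (act M (uF * uF) v) = act M (casimir * (uF * uF)) v"
    using v by (simp_all add: act_mult usl2_even_gens casimir_even)
  with v show ?thesis
    unfolding HFF CFF weight_vector_def
    by (simp add: act_mult act_diff act_scale act_usl2_scale act_closed usl2_even_gens casimir_even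
        usl2_even_subalgebra(3) usl2_even_scale scale_left_diff_distrib)
qed

lemma weight_vector_EE:
  assumes "weight_vector \<theta> c v"
  shows "weight_vector (\<theta> + 4) c (act M (uE * uE) v)"
proof -
  have v: "v \<in> umod.carrier M" "act M uH v = umod.smult M \<theta> v" "act M casimir v = umod.smult M c v"
    using assms by (auto simp: weight_vector_def)
  have HEE: "uH * (uE * uE) = (uE * uE) * uH + usl2_scale 4 (uE * uE)"
    by (simp add: usl2_scale_numerals mult.assoc normal_order right_diff_distrib)
  have CEE: "casimir * (uE * uE) = (uE * uE) * casimir"
    by (metis casimir_commutes(1) mult.assoc)
  have "act M uH (act M (uE * uE) v) = act M (uH * (uE * uE)) v"
    "act M casimir (act M (uE * uE) v) = act M (casimir * (uE * uE)) v"
    using v by (simp_all add: act_mult usl2_even_gens casimir_even)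
  with v show ?thesis
    unfolding HEE CEE weight_vector_def
    by (simp add: act_mult act_plus act_scale act_usl2_scale act_closed usl2_even_gens casimir_even
        usl2_even_subalgebra(3) usl2_even_scale scale_left_distrib)
qed

lemma weight_vectors_indep_family:
  assumes "finite I" "\<And>i. i \<in> I \<Longrightarrow> weight_vector (\<mu> i) c (w i)" "\<And>i. i \<in> I \<Longrightarrow> w i \<noteq> 0" "inj_on \<mu> I"
  shows "indep_family I w"
  by (rule eigenvectors_indep_family[OF assms(1) subspace_carrier, of "act M uH" w \<mu>])
    (use assms in \<open>auto simp: weight_vector_def act_add act_scale usl2_even_gens\<close>)

text \<open>Nonzero vectors of distinct weights are independent, so an infinite string of them does not fit into finite
  dimension.\<close>

lemma weight_string_vanishes:
  assumes B: "finite B" "umod.carrier M \<subseteq> span B"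
    and w: "\<And>k. weight_vector (\<theta> + r * of_nat k) c (w k)" and "r \<noteq> 0"
  shows "\<exists>k. w k = 0"
proof (rule ccontr)
  assume "\<nexists>k. w k = 0"
  then have "indep_family {..card B} w"
    using w \<open>r \<noteq> 0\<close> by (intro weight_vectors_indep_family[of _ "\<lambda>k. \<theta> + r * of_nat k" c]) (auto simp: inj_on_def)
  then have "card {..card B} \<le> card B"
    using B w by (intro indep_family_card_le) (auto simp: weight_vector_def)
  then show False by simp
qed

text \<open>The Casimir element commutes with \<open>H\<close>, hence has an eigenvector in an eigenspace of \<open>H\<close>;
  raising it by \<open>E\<^sup>2\<close> must stop, since the weights that occur are distinct.\<close>

lemma highest_weight_vector_exists:
  assumes B: "finite B" "umod.carrier M \<subseteq> span B" and "umod.carrier M \<noteq> {0}"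
  shows "\<exists>\<theta> c v. v \<noteq> 0 \<and> weight_vector \<theta> c v \<and> act M (uE * uE) v = 0"
proof -
  obtain \<theta> u where u: "u \<in> umod.carrier M" "u \<noteq> 0" "act M uH u = umod.smult M \<theta> u"
    using eigenvector_exists[OF vector_space_axioms subspace_carrier B assms(3), of "act M uH"]
    by (auto simp: act_closed act_add act_scale usl2_even_gens)
  define W where "W = weight_space M \<theta>"
  have W: "v \<in> W \<longleftrightarrow> v \<in> umod.carrier M \<and> act M uH v = umod.smult M \<theta> v" for v
    by (auto simp: W_def weight_space_def)
  have sub: "subspace W"
    by (rule subspaceI) (auto simp: W act_zero act_add act_scale usl2_even_gens scale_right_distrib scale_left_commute
        subspace_0[OF subspace_carrier] subspace_add[OF subspace_carrier] subspace_scale[OF subspace_carrier])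
  have casimir_W: "act M casimir v \<in> W" if "v \<in> W" for v
  proof -
    have "act M uH (act M casimir v) = act M (uH * casimir) v"
      using that by (simp add: W act_mult usl2_even_gens casimir_even)
    also have "\<dots> = act M casimir (act M uH v)"
      unfolding casimir_commutes(3)[symmetric] using that by (simp add: W act_mult usl2_even_gens casimir_even)
    finally show ?thesis using that by (simp add: W act_closed act_scale casimir_even)
  qed
  have "\<exists>c. \<exists>v\<in>W. v \<noteq> 0 \<and> act M casimir v = umod.smult M c v"
  proof (rule eigenvector_exists[OF vector_space_axioms sub B(1)])
    show "W \<subseteq> span B" using B(2) by (auto simp: W)
    show "W \<noteq> {0}" using u W by auto
  qed (use casimir_W in \<open>auto simp: W act_add act_scale casimir_even\<close>)
  then obtain c v where v: "v \<noteq> 0" "weight_vector \<theta> c v" by (auto simp: W weight_vector_def)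
  define w where "w k = (act M (uE * uE) ^^ k) v" for k
  have w: "weight_vector (\<theta> + 4 * of_nat k) c (w k)" for k
  proof (induction k)
    case (Suc k)
    from weight_vector_EE[OF this] show ?case by (simp add: w_def algebra_simps)
  qed (use v in \<open>simp add: w_def\<close>)
  then obtain k where "w k = 0" using weight_string_vanishes[OF B w] by auto
  moreover have "w 0 \<noteq> 0" using v by (simp add: w_def)
  ultimately obtain j where "w j \<noteq> 0" "w (Suc j) = 0"
    using ex_least_nat_less[of "\<lambda>k. w k = 0" k] by auto
  then show ?thesis using w[of j] by (auto simp: w_def)
qed

end

section \<open>Lowering chains\<close>

context even_module
begin

text \<open>The shape of a module generated by a highest weight vector \<open>w 0\<close>; both its dimension \<open>d + 1\<close> and the
  way that the generators act can be read off from the parameters.\<close>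

definition lowering_chain :: "nat \<Rightarrow> complex \<Rightarrow> complex \<Rightarrow> (nat \<Rightarrow> 'v) \<Rightarrow> bool" where
  "lowering_chain d \<nu> c w \<longleftrightarrow>
     umod.carrier M = span (w ` {..d}) \<and>
     (\<forall>i\<le>d. w i \<noteq> 0 \<and> weight_vector (\<nu> - 4 * of_nat i) c (w i)) \<and>
     (\<forall>i<d. act M (uF * uF) (w i) = w (Suc i)) \<and>
     act M (uF * uF) (w d) = 0 \<and> act M (uE * uE) (w 0) = 0"

text \<open>The scalar by which \<open>E\<^sup>2 F\<^sup>2\<close> acts in weight \<open>\<theta>\<close>, that is, by which \<open>E\<^sup>2\<close> takes \<open>w (Suc i)\<close> back to \<open>w i\<close>.\<close>

definition raising_coeff :: "complex \<Rightarrow> complex \<Rightarrow> complex" where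
  "raising_coeff c \<theta> = (c - \<theta>\<^sup>2 + 2 * \<theta>) * (c - \<theta>\<^sup>2 + 6 * \<theta> - 8) / 16"

lemma lowering_chain_carrier:
  "lowering_chain d \<nu> c w \<Longrightarrow> i \<le> d \<Longrightarrow> w i \<in> umod.carrier M"
  by (auto simp: lowering_chain_def weight_vector_def)

lemma lowering_chain_EE:
  assumes "lowering_chain d \<nu> c w" "i < d"
  shows "act M (uE * uE) (w (Suc i)) = umod.smult M (raising_coeff c (\<nu> - 4 * of_nat i)) (w i)"
  using assms weight_vector_EEFF[of "\<nu> - 4 * of_nat i" c "w i"]
  by (auto simp: lowering_chain_def raising_coeff_def)

lemma lowering_chain_indep:
  assumes "lowering_chain d \<nu> c w"
  shows "indep_family {..d} w"
  using assms
  by (intro weight_vectors_indep_family[of _ "\<lambda>i. \<nu> - 4 * of_nat i" c])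
    (auto simp: lowering_chain_def inj_on_def)

lemma lowering_chain_dim:
  assumes "lowering_chain d \<nu> c w"
  shows "umod_dim M = d + 1"
proof -
  note ind = indep_family_independent[OF finite_atMost lowering_chain_indep[OF assms]]
  have "umod_dim M = dim (span (w ` {..d}))"
    using assms by (simp add: umod_dim_def lowering_chain_def)
  also have "\<dots> = d + 1"
    using dim_span_eq_card_independent[OF ind(2)] card_image[OF ind(1)] by simp
  finally show ?thesis .
qed

text \<open>Powers of \<open>E\<^sup>2\<close> take a nonzero vector of a submodule to a nonzero multiple of \<open>w 0\<close>: the last
  term of its expansion arrives there when all earlier ones have been killed. From \<open>w 0\<close>, powers of \<open>F\<^sup>2\<close> reach
  the whole chain.\<close>

lemma lowering_chain_irreducible:
  assumes chain: "lowering_chain d \<nu> c w"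
    and raise: "\<And>i. i < d \<Longrightarrow> raising_coeff c (\<nu> - 4 * of_nat i) \<noteq> 0"
  shows "irreducible_umod usl2_even M"
  unfolding irreducible_umod_def
proof (intro conjI allI impI umod)
  have w: "w i \<noteq> 0" "w i \<in> umod.carrier M" if "i \<le> d" for i
    using chain that lowering_chain_carrier[OF chain that] by (simp_all add: lowering_chain_def)
  have carrier: "umod.carrier M = span (w ` {..d})"
    and FF: "\<And>i. i < d \<Longrightarrow> act M (uF * uF) (w i) = w (Suc i)"
    using chain by (simp_all add: lowering_chain_def)
  show "umod.carrier M \<noteq> {0}" using w[of 0] by auto
  fix W assume "is_submodule usl2_even W M"
  then have W: "W \<subseteq> umod.carrier M" "subspace W" and W_act: "\<And>a v. a \<in> usl2_even \<Longrightarrow> v \<in> W \<Longrightarrow> act M a v \<in> W"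
    by (auto simp: is_submodule_def)
  have top: "w 0 \<in> W" if "(\<Sum>i\<le>m. umod.smult M (a i) (w i)) \<in> W" "a m \<noteq> 0" "m \<le> d" for a m
    using that
  proof (induction m arbitrary: a)
    case 0
    then have "umod.smult M (a 0) (w 0) \<in> W" by simp
    from subspace_scale[OF W(2) this, of "inverse (a 0)"] show ?case
      unfolding scale_scale left_inverse[OF 0(2)] scale_one .
  next
    case (Suc m)
    have "act M (uE * uE) (\<Sum>i\<le>Suc m. umod.smult M (a i) (w i)) =
        (\<Sum>i\<le>Suc m. umod.smult M (a i) (act M (uE * uE) (w i)))"
      using Suc.prems w by (intro act_sum usl2_even_gens) auto
    also have "\<dots> = (\<Sum>i\<le>m. umod.smult M (a (Suc i)) (act M (uE * uE) (w (Suc i))))"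
      using chain by (subst sum.atMost_Suc_shift) (simp add: lowering_chain_def)
    also have "\<dots> = (\<Sum>i\<le>m. umod.smult M (a (Suc i) * raising_coeff c (\<nu> - 4 * of_nat i)) (w i))"
      using Suc.prems lowering_chain_EE[OF chain] by (intro sum.cong) auto
    finally have "(\<Sum>i\<le>m. umod.smult M (a (Suc i) * raising_coeff c (\<nu> - 4 * of_nat i)) (w i)) \<in> W"
      using W_act[OF usl2_even_gens(1) Suc.prems(1)] by simp
    then show ?case
      by (rule Suc.IH) (use Suc.prems raise[of m] in auto)
  qed
  show "W = {0} \<or> W = umod.carrier M"
  proof (rule disjCI)
    assume "W \<noteq> umod.carrier M"
    have "w 0 \<notin> W"
    proof
      assume "w 0 \<in> W"
      have "w i \<in> W" if "i \<le> d" for i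
        using that
      proof (induction i)
        case (Suc i)
        then have "act M (uF * uF) (w i) \<in> W" by (intro W_act usl2_even_gens) simp
        then show ?case unfolding FF[OF Suc_le_lessD[OF Suc.prems]] .
      qed (rule \<open>w 0 \<in> W\<close>)
      then have "umod.carrier M \<subseteq> W"
        unfolding carrier using W(2) by (intro span_minimal) auto
      with W \<open>W \<noteq> umod.carrier M\<close> show False by blast
    qed
    have "u = 0" if "u \<in> W" for u
    proof (rule ccontr)
      assume "u \<noteq> 0"
      have "u \<in> span (w ` {..d})" using that W(1) unfolding carrier by blast
      then obtain a where a: "u = (\<Sum>i\<le>d. umod.smult M (a i) (w i))"
        by (rule span_image_sumE) simp
      define m where "m = Max {i. i \<le> d \<and> a i \<noteq> 0}"
      have fin: "finite {i. i \<le> d \<and> a i \<noteq> 0}" by simp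
      moreover have "{i. i \<le> d \<and> a i \<noteq> 0} \<noteq> {}"
        using \<open>u \<noteq> 0\<close> a by (auto intro: sum.neutral)
      ultimately have m: "m \<le> d" "a m \<noteq> 0" using Max_in unfolding m_def by blast+
      have "a i = 0" if "i \<le> d" "m < i" for i
        using that Max_ge[OF fin, of i] unfolding m_def by fastforce
      then have "u = (\<Sum>i\<le>m. umod.smult M (a i) (w i))"
        unfolding a using m by (intro sum.mono_neutral_right) auto
      with \<open>u \<in> W\<close> top[of a m] m \<open>w 0 \<notin> W\<close> show False by simp
    qed
    then show "W = {0}" using subspace_0[OF W(2)] by auto
  qed
qed

text \<open>Following a highest weight vector down by \<open>F\<^sup>2\<close> until it vanishes gives a submodule, since
  \<open>E\<^sup>2 F\<^sup>2\<close> acts on weight vectors by scalars.\<close>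

lemma irreducible_has_lowering_chain:
  assumes irr: "irreducible_umod usl2_even M" and dim: "umod_dim M = d + 1"
  obtains \<nu> c w where "lowering_chain d \<nu> c w"
proof -
  obtain B where B: "B \<subseteq> umod.carrier M" "independent B" "umod.carrier M \<subseteq> span B" "card B = dim (umod.carrier M)"
    by (rule basis_exists)
  then have fin: "finite B" using dim by (intro card_ge_0_finite) (simp add: umod_dim_def)
  obtain \<nu> c v where v: "v \<noteq> 0" "weight_vector \<nu> c v" "act M (uE * uE) v = 0"
    using highest_weight_vector_exists[OF fin B(3)] irr by (auto simp: irreducible_umod_def)
  define w where "w k = (act M (uF * uF) ^^ k) v" for k
  have w: "weight_vector (\<nu> - 4 * of_nat k) c (w k)" for k
  proof (induction k)
    case (Suc k)
    from weight_vector_FF[OF this] show ?case by (simp add: w_def algebra_simps)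
  qed (use v in \<open>simp add: w_def\<close>)
  then have "\<exists>k. w k = 0" using weight_string_vanishes[OF fin B(3), of \<nu> "- 4"] by auto
  then obtain k where "w k = 0" ..
  moreover have w0: "w 0 \<noteq> 0" using v by (simp add: w_def)
  ultimately obtain m where m: "\<And>i. i \<le> m \<Longrightarrow> w i \<noteq> 0" "w (Suc m) = 0"
    using ex_least_nat_less[of "\<lambda>k. w k = 0" k] by auto
  have FF: "act M (uF * uF) (w i) = w (Suc i)" for i by (simp add: w_def)
  have wc: "w ` {..m} \<subseteq> umod.carrier M" using w by (auto simp: weight_vector_def)
  have gens: "act M a x \<in> span (w ` {..m})"
    if a: "a \<in> {uE * uE, uF * uF, uH, casimir}" and x: "x \<in> w ` {..m}" for a x
  proof -
    from x obtain i where i: "x = w i" "i \<le> m" by auto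
    have base: "w j \<in> span (w ` {..m})" if "j \<le> m" for j using that by (intro span_base) auto
    have "act M (uF * uF) x \<in> span (w ` {..m})"
      using i m base[of "Suc i"] by (cases "i = m") (auto simp: FF span_zero)
    moreover have "act M (uE * uE) x \<in> span (w ` {..m})"
    proof (cases i)
      case 0
      then show ?thesis using i v by (simp add: w_def span_zero)
    next
      case (Suc j)
      then show ?thesis
        using i weight_vector_EEFF[OF w[of j]] base[of j] by (auto simp: FF intro: span_scale)
    qed
    moreover have "act M uH x \<in> span (w ` {..m})" "act M casimir x \<in> span (w ` {..m})"
      using w[of i] base i by (auto simp: weight_vector_def intro: span_scale)
    ultimately show ?thesis using a by auto
  qed
  have "is_submodule usl2_even (span (w ` {..m})) M"
    unfolding is_submodule_def
    using span_minimal[OF wc subspace_carrier] span_invariant[OF wc gens] by simp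
  moreover have "span (w ` {..m}) \<noteq> {0}" using w0 span_base[of "w 0" "w ` {..m}"] by auto
  ultimately have span: "span (w ` {..m}) = umod.carrier M"
    using irr by (auto simp: irreducible_umod_def)
  have chain: "lowering_chain m \<nu> c w"
    using span m w v by (auto simp: lowering_chain_def FF) (simp add: w_def)
  then have "m = d" using lowering_chain_dim dim by auto
  with chain that show thesis by blast
qed

text \<open>Both ends of the chain give an equation, \<open>F\<^sup>2 E\<^sup>2 w\<^sub>0 = 0\<close> and \<open>E\<^sup>2 F\<^sup>2 w\<^sub>d = 0\<close>. As quadratic
  equations in \<open>\<nu> + 1\<close> and \<open>\<nu> - 4 d - 1\<close> they say that \<open>c + 1\<close> is the square of \<open>\<nu> + 1\<close> or
  \<open>\<nu> + 3\<close>, and of \<open>\<nu> - 4 d - 1\<close> or \<open>\<nu> - 4 d - 3\<close>.\<close>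

lemma lowering_chain_parameters:
  assumes chain: "lowering_chain d \<nu> c w"
  shows "(\<nu>, c) \<in> {(2 * of_nat d, of_nat (2 * d) * of_nat (2 * d + 2)),
    (2 * of_nat d + 1, of_nat (2 * d + 1) * of_nat (2 * d + 3)),
    (2 * of_nat d - 1, of_nat (2 * d + 1) * of_nat (2 * d + 3)),
    (2 * of_nat d, of_nat (2 * d + 2) * of_nat (2 * d + 4))}"
proof -
  define n :: complex where "n = of_nat d"
  define \<mu> where "\<mu> = \<nu> - 4 * n"
  have w: "w 0 \<noteq> 0" "weight_vector \<nu> c (w 0)" "w d \<noteq> 0" "weight_vector \<mu> c (w d)"
    "act M (uE * uE) (w 0) = 0" "act M (uF * uF) (w d) = 0"
    using chain by (auto simp: lowering_chain_def \<mu>_def n_def)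
  have "(c - \<nu>\<^sup>2 - 2 * \<nu>) * (c - \<nu>\<^sup>2 - 6 * \<nu> - 8) = 0"
    using weight_vector_FFEE[OF w(2)] w by (simp add: act_zero usl2_even_gens)
  then have top: "c + 1 = (\<nu> + 1)\<^sup>2 \<or> c + 1 = (\<nu> + 3)\<^sup>2"
    by (simp only: mult_eq_0_iff) (auto simp: power2_eq_square algebra_simps)
  have "(c - \<mu>\<^sup>2 + 2 * \<mu>) * (c - \<mu>\<^sup>2 + 6 * \<mu> - 8) = 0"
    using weight_vector_EEFF[OF w(4)] w by (simp add: act_zero usl2_even_gens)
  then have bottom: "c + 1 = (\<mu> - 1)\<^sup>2 \<or> c + 1 = (\<mu> - 3)\<^sup>2"
    by (simp only: mult_eq_0_iff) (auto simp: power2_eq_square algebra_simps)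
  \<comment> \<open>Excludes the solutions with equal signs, which force \<open>4 d\<close> to be negative.\<close>
  have n: "of_nat k * n + of_nat (Suc j) \<noteq> 0" for k j
    using of_nat_neq_0[of "k * d + j", where 'a = complex] by (simp add: n_def algebra_simps)
  have eq: "\<nu> + a = \<mu> + b \<or> \<nu> + a = - (\<mu> + b)" if "(\<nu> + a)\<^sup>2 = (\<mu> + b)\<^sup>2" for a b
    using that by (simp add: power2_eq_iff)
  from top bottom consider
    "c + 1 = (\<nu> + 1)\<^sup>2" "(\<nu> + 1)\<^sup>2 = (\<mu> + - 1)\<^sup>2" | "c + 1 = (\<nu> + 1)\<^sup>2" "(\<nu> + 1)\<^sup>2 = (\<mu> + - 3)\<^sup>2"
    | "c + 1 = (\<nu> + 3)\<^sup>2" "(\<nu> + 3)\<^sup>2 = (\<mu> + - 1)\<^sup>2" | "c + 1 = (\<nu> + 3)\<^sup>2" "(\<nu> + 3)\<^sup>2 = (\<mu> + - 3)\<^sup>2"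
    by auto
  then show ?thesis
  proof cases
    case 1
    have "2 * \<nu> = 2 * (2 * n)" using eq[OF 1(2)] n[of 4 1] by (auto simp: \<mu>_def algebra_simps)
    then have "\<nu> = 2 * n" unfolding mult_cancel_left by simp
    with 1(1) show ?thesis by (simp add: n_def power2_eq_square algebra_simps)
  next
    case 2
    have "2 * \<nu> = 2 * (2 * n + 1)" using eq[OF 2(2)] n[of 4 3] by (auto simp: \<mu>_def algebra_simps)
    then have "\<nu> = 2 * n + 1" unfolding mult_cancel_left by simp
    with 2(1) show ?thesis by (simp add: n_def power2_eq_square algebra_simps)
  next
    case 3
    have "2 * \<nu> = 2 * (2 * n - 1)" using eq[OF 3(2)] n[of 4 3] by (auto simp: \<mu>_def algebra_simps)
    then have "\<nu> = 2 * n - 1" unfolding mult_cancel_left by simp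
    with 3(1) show ?thesis by (simp add: n_def power2_eq_square algebra_simps)
  next
    case 4
    have "2 * \<nu> = 2 * (2 * n)" using eq[OF 4(2)] n[of 4 5] by (auto simp: \<mu>_def algebra_simps)
    then have "\<nu> = 2 * n" unfolding mult_cancel_left by simp
    with 4(1) show ?thesis by (simp add: n_def power2_eq_square algebra_simps)
  qed
qed

end
text \<open>The linear map that matches the two chains commutes with the four generators, since each of them takes a
  chain vector to a multiple of a chain vector, with a factor that depends on the parameters alone.\<close>

lemma lowering_chain_iso:
  fixes M :: "'v::ab_group_add umod" and N :: "'w::ab_group_add umod"
  assumes M: "even_module M" and N: "even_module N"
    and w: "even_module.lowering_chain M d \<nu> c w" and u: "even_module.lowering_chain N d \<nu> c u"
  shows "umod_iso usl2_even M N"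
proof -
  interpret M: even_module M by fact
  interpret N: even_module N by fact
  interpret MN: vector_space_pair "umod.smult M" "umod.smult N"
    by (intro vector_space_pair.intro M.vector_space_axioms N.vector_space_axioms)
  note indM = M.lowering_chain_indep[OF w] and indN = N.lowering_chain_indep[OF u]
  note basis = M.indep_family_independent[OF finite_atMost indM]
  have carM: "umod.carrier M = M.span (w ` {..d})" and carN: "umod.carrier N = N.span (u ` {..d})"
    using w u by (simp_all add: M.lowering_chain_def N.lowering_chain_def)
  note wM = M.lowering_chain_carrier[OF w] and uN = N.lowering_chain_carrier[OF u]
  define f where "f = MN.construct (w ` {..d}) (u \<circ> the_inv_into {..d} w)"
  interpret f: Vector_Spaces.linear "umod.smult M" "umod.smult N" f
    unfolding f_def by (rule MN.linear_construct[OF basis(2)])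
  have fw: "f (w i) = u i" if "i \<le> d" for i
    using that unfolding f_def by (subst MN.construct_basis[OF basis(2)]) (auto simp: the_inv_into_f_f[OF basis(1)])
  have f_sum: "f (\<Sum>i\<le>d. umod.smult M (a i) (w i)) = (\<Sum>i\<le>d. umod.smult N (a i) (u i))" for a
    by (simp add: f.sum f.scale fw)
  have f_carrier: "f v \<in> umod.carrier N" if "v \<in> umod.carrier M" for v
  proof -
    from that obtain a where "v = (\<Sum>i\<le>d. umod.smult M (a i) (w i))"
      unfolding carM by (rule M.span_image_sumE) simp
    then show ?thesis
      using uN by (auto simp: f_sum intro!: N.subspace_sum N.subspace_scale N.subspace_carrier)
  qed
  have bij: "bij_betw f (umod.carrier M) (umod.carrier N)"
    unfolding bij_betw_def
  proof (intro conjI equalityI subsetI)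
    show "inj_on f (umod.carrier M)"
    proof (rule inj_onI)
      fix x y assume "x \<in> umod.carrier M" "y \<in> umod.carrier M" and fxy: "f x = f y"
      then have "x - y \<in> M.span (w ` {..d})" using carM M.span_diff by metis
      then obtain a where a: "x - y = (\<Sum>i\<le>d. umod.smult M (a i) (w i))"
        by (rule M.span_image_sumE) simp
      have "(\<Sum>i\<le>d. umod.smult N (a i) (u i)) = f (x - y)" unfolding a f_sum ..
      also have "\<dots> = 0" using fxy by (simp add: f.diff)
      finally have "a i = 0" if "i \<le> d" for i using N.indep_familyD[OF indN] that by blast
      with a show "x = y" by simp
    qed
    fix y
    { assume "y \<in> f ` umod.carrier M"
      then show "y \<in> umod.carrier N" using f_carrier by auto }
    assume "y \<in> umod.carrier N"
    then obtain a where "y = (\<Sum>i\<le>d. umod.smult N (a i) (u i))"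
      unfolding carN by (rule N.span_image_sumE) simp
    then have "y = f (\<Sum>i\<le>d. umod.smult M (a i) (w i))" by (simp add: f_sum)
    moreover have "(\<Sum>i\<le>d. umod.smult M (a i) (w i)) \<in> umod.carrier M"
      using wM by (intro M.subspace_sum M.subspace_scale M.subspace_carrier) auto
    ultimately show "y \<in> f ` umod.carrier M" by blast
  qed
  have on_chain: "f (act M a v) = act N a (f v)"
    if a: "a \<in> usl2_even" and ai: "\<And>i. i \<le> d \<Longrightarrow> f (act M a (w i)) = act N a (u i)"
      and v: "v \<in> umod.carrier M" for a v
  proof -
    from v obtain b where b: "v = (\<Sum>i\<le>d. umod.smult M (b i) (w i))"
      unfolding carM by (rule M.span_image_sumE) simp
    have "act M a v = (\<Sum>i\<le>d. umod.smult M (b i) (act M a (w i)))"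
      unfolding b using wM by (intro M.act_sum a) auto
    moreover have "act N a (f v) = (\<Sum>i\<le>d. umod.smult N (b i) (act N a (u i)))"
      unfolding b f_sum using uN by (intro N.act_sum a) auto
    ultimately show ?thesis by (simp add: f.sum f.scale ai)
  qed
  have hom: "\<forall>v\<in>umod.carrier M. f (act M a v) = act N a (f v)" if "a \<in> usl2_even" for a
    using that
  proof (induction rule: usl2_even_induct)
    case one
    show ?case by (simp add: M.act_one N.act_one f_carrier)
  next
    case EE
    have "f (act M (uE * uE) (w i)) = act N (uE * uE) (u i)" if "i \<le> d" for i
    proof (cases i)
      case 0
      then show ?thesis using w u by (simp add: M.lowering_chain_def N.lowering_chain_def)
    next
      case (Suc j)
      then show ?thesis using that
        by (simp add: M.lowering_chain_EE[OF w] N.lowering_chain_EE[OF u] f.scale fw)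
    qed
    then show ?case by (blast intro: on_chain usl2_even_gens)
  next
    case FF
    have "f (act M (uF * uF) (w i)) = act N (uF * uF) (u i)" if "i \<le> d" for i
      using that w u by (cases "i = d") (auto simp: M.lowering_chain_def N.lowering_chain_def fw)
    then show ?case by (blast intro: on_chain usl2_even_gens)
  next
    case H
    have "f (act M uH (w i)) = act N uH (u i)" if "i \<le> d" for i
      using that w u by (auto simp: M.lowering_chain_def N.lowering_chain_def M.weight_vector_def
          N.weight_vector_def f.scale fw)
    then show ?case by (blast intro: on_chain usl2_even_gens)
  next
    case casimir
    have "f (act M casimir (w i)) = act N casimir (u i)" if "i \<le> d" for i
      using that w u by (auto simp: M.lowering_chain_def N.lowering_chain_def M.weight_vector_def
          N.weight_vector_def f.scale fw)
    then show ?case by (blast intro: on_chain casimir_even)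
  next
    case (add x y)
    then show ?case by (simp add: M.act_plus N.act_plus f_carrier f.add)
  next
    case (scale k x)
    then show ?case by (simp add: M.act_usl2_scale N.act_usl2_scale f_carrier f.scale)
  next
    case (mult x y)
    then show ?case by (simp add: M.act_mult N.act_mult M.act_closed f_carrier)
  qed
  show ?thesis
    unfolding umod_iso_def using bij hom by (intro exI[of _ f]) (auto simp: f.add f.scale)
qed

section \<open>The even and odd parts of \<open>L\<^sub>n\<close> as lowering chains\<close>

lemma is_umod_submodule:
  assumes "is_umod A M" "is_submodule A W M"
  shows "is_umod A (M\<lparr>umod.carrier := W\<rparr>)"
  using assms by (auto simp: is_umod_def is_submodule_def subset_iff)

lemma even_module_L_mod: "even_module (L_mod n)"
  using L_mod_is_umod[of n] by (simp add: even_module_def is_umod_def)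

lemma L_act_bvec:
  "L_act n uH (bvec j) = (if j \<le> n then pm_scale (of_nat n - 2 * of_nat j) (bvec j) else 0)"
  "j \<le> n \<Longrightarrow> L_act n casimir (bvec j) = pm_scale (of_nat n * (of_nat n + 2)) (bvec j)"
  "L_act n (uF * uF) (bvec j) =
    (if j + 2 \<le> n then pm_scale ((of_nat j + 1) * (of_nat j + 2)) (bvec (j + 2)) else 0)"
  "j \<le> n \<Longrightarrow> L_act n (uE * uE) (bvec j) =
    (if 2 \<le> j then pm_scale ((of_nat n - of_nat j + 1) * (of_nat n - of_nat j + 2)) (bvec (j - 2)) else 0)"
proof -
  show "L_act n uH (bvec j) = (if j \<le> n then pm_scale (of_nat n - 2 * of_nat j) (bvec j) else 0)"
    by (simp add: L_act_gen del: single_one)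
  show "L_act n (uF * uF) (bvec j) =
    (if j + 2 \<le> n then pm_scale ((of_nat j + 1) * (of_nat j + 2)) (bvec (j + 2)) else 0)"
    by (auto simp: L_act_linear L_act_gen simp del: single_one intro!: arg_cong2[where f = pm_scale])
  show "L_act n (uE * uE) (bvec j) =
    (if 2 \<le> j then pm_scale ((of_nat n - of_nat j + 1) * (of_nat n - of_nat j + 2)) (bvec (j - 2)) else 0)"
    if "j \<le> n"
    using that by (auto simp: L_act_linear L_act_gen of_nat_diff numeral_2_eq_2 simp del: single_one
        intro!: arg_cong2[where f = pm_scale])
  assume j: "j \<le> n"
  have FE: "L_act n (uF * uE) (bvec j) = pm_scale ((of_nat n - of_nat j + 1) * of_nat j) (bvec j)"
    using j by (cases j) (simp_all add: L_act_linear L_act_gen del: single_one)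
  have "L_act n casimir (bvec j) = pm_scale (4 * ((of_nat n - of_nat j + 1) * of_nat j) +
      (of_nat n - 2 * of_nat j) * (of_nat n - 2 * of_nat j) + 2 * (of_nat n - 2 * of_nat j)) (bvec j)"
    unfolding casimir_def using j FE
    by (simp add: L_act_linear L_act_gen del: single_one flip: pm.scale_left_distrib)
  also have "4 * ((of_nat n - of_nat j + 1) * of_nat j) + (of_nat n - 2 * of_nat j) * (of_nat n - 2 * of_nat j) +
      2 * (of_nat n - 2 * of_nat j) = (of_nat n * (of_nat n + 2) :: complex)"
    by (simp add: algebra_simps)
  finally show "L_act n casimir (bvec j) = pm_scale (of_nat n * (of_nat n + 2)) (bvec j)" .
qed

text \<open>For \<open>\<epsilon> = 0\<close> and \<open>\<epsilon> = 1\<close> this is \<open>L\<^sub>n\<^sup>(\<^sup>0\<^sup>)\<close> and \<open>L\<^sub>n\<^sup>(\<^sup>1\<^sup>)\<close>, provided that \<open>2 d + \<epsilon>\<close> is the largest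
  index of its parity up to \<open>n\<close>.\<close>

definition L_part :: "nat \<Rightarrow> nat \<Rightarrow> nat \<Rightarrow> (nat \<Rightarrow>\<^sub>0 complex) umod" where
  "L_part n \<epsilon> d = (L_mod n)\<lparr>umod.carrier := pm_span ((\<lambda>i. bvec (2 * i + \<epsilon>)) ` {..d})\<rparr>"

lemma even_module_L_part:
  assumes "\<epsilon> \<le> 1" "2 * d + \<epsilon> \<le> n" "n \<le> 2 * d + \<epsilon> + 1"
  shows "even_module (L_part n \<epsilon> d)"
proof -
  interpret L: even_module "L_mod n" by (rule even_module_L_mod)
  let ?X = "(\<lambda>i. bvec (2 * i + \<epsilon>)) ` {..d}"
  have simps: "umod.smult (L_mod n) = pm_scale" "act (L_mod n) = L_act n"
    "umod.carrier (L_mod n) = pm_span (bvec ` {0..n})"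
    by (simp_all add: L_mod_def)
  have L_span: "L.span = pm_span" by (simp add: simps pm_span_def)
  have X: "?X \<subseteq> umod.carrier (L_mod n)"
    using assms unfolding simps by (auto intro!: pm.span_base)
  have gens: "act (L_mod n) a x \<in> L.span ?X"
    if a: "a \<in> {uE * uE, uF * uF, uH, casimir}" and x: "x \<in> ?X" for a x
  proof -
    from x obtain i where i: "x = bvec (2 * i + \<epsilon>)" "i \<le> d" by auto
    then have le: "2 * i + \<epsilon> \<le> n" using assms by simp
    have base: "bvec (2 * k + \<epsilon>) \<in> pm_span ?X" if "k \<le> d" for k
      using that by (intro pm.span_base) auto
    have "L_act n (uF * uF) x \<in> pm_span ?X"
      using base[of "Suc i"] assms unfolding i L_act_bvec
      by (auto simp: pm.span_zero intro: pm.span_scale simp del: single_one)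
    moreover have "L_act n (uE * uE) x \<in> pm_span ?X"
      using base[of "i - 1"] i assms unfolding i L_act_bvec(4)[OF le]
      by (cases i) (auto simp: pm.span_zero intro: pm.span_scale simp del: single_one)
    moreover have "L_act n uH x \<in> pm_span ?X" "L_act n casimir x \<in> pm_span ?X"
      using base[of i] i le by (auto simp: L_act_bvec pm.span_zero intro: pm.span_scale simp del: single_one)
    ultimately show ?thesis using a unfolding simps pm_span_def by blast
  qed
  have "is_submodule usl2_even (L.span ?X) (L_mod n)"
    unfolding is_submodule_def
    using L.span_minimal[OF X L.subspace_carrier] L.span_invariant[OF X gens] by simp
  then show ?thesis
    unfolding even_module_def L_part_def
    using is_umod_submodule[OF L.umod] unfolding L_span by blast
qed

text \<open>The factorials turn \<open>F\<^sup>2 v\<^sub>j = (j + 1) (j + 2) v\<^bsub>j + 2\<^esub>\<close> into \<open>F\<^sup>2 w\<^sub>i = w\<^bsub>i + 1\<^esub>\<close>.\<close>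

lemma lowering_chain_L_part:
  assumes "\<epsilon> \<le> 1" "2 * d + \<epsilon> \<le> n" "n \<le> 2 * d + \<epsilon> + 1"
  shows "even_module.lowering_chain (L_part n \<epsilon> d) d (of_nat n - 2 * of_nat \<epsilon>) (of_nat n * (of_nat n + 2))
    (\<lambda>i. pm_scale (fact (2 * i + \<epsilon>)) (bvec (2 * i + \<epsilon>)))"
proof -
  interpret N: even_module "L_part n \<epsilon> d" using assms by (rule even_module_L_part)
  let ?X = "(\<lambda>i. bvec (2 * i + \<epsilon>)) ` {..d}"
  let ?w = "\<lambda>i. pm_scale (fact (2 * i + \<epsilon>)) (bvec (2 * i + \<epsilon>))"
  have simps: "umod.smult (L_part n \<epsilon> d) = pm_scale" "act (L_part n \<epsilon> d) = L_act n"
    "umod.carrier (L_part n \<epsilon> d) = pm_span ?X"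
    by (simp_all add: L_part_def L_mod_def)
  have w_span: "?w i \<in> pm_span ?X" if "i \<le> d" for i
    using that by (intro pm.span_scale pm.span_base) auto
  have "bvec (2 * i + \<epsilon>) \<in> pm_span (?w ` {..d})" if "i \<le> d" for i
  proof -
    have "pm_scale (1 / fact (2 * i + \<epsilon>)) (?w i) \<in> pm_span (?w ` {..d})"
      using that by (intro pm.span_scale pm.span_base) auto
    then show ?thesis by (simp del: single_one)
  qed
  then have span: "pm_span ?X = pm_span (?w ` {..d})"
    using w_span by (subst pm.span_eq) (auto simp del: single_one)
  have "?w i \<noteq> 0" for i
    by (metis lookup_pm_scale lookup_single_eq lookup_zero mult_cancel_left1 mult_zero_left fact_nonzero mult.right_neutral)
  moreover have "N.weight_vector (of_nat n - 2 * of_nat \<epsilon> - 4 * of_nat i) (of_nat n * (of_nat n + 2)) (?w i)"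
    if "i \<le> d" for i
  proof -
    have le: "2 * i + \<epsilon> \<le> n" using that assms by simp
    have "of_nat n - 2 * of_nat (2 * i + \<epsilon>) = (of_nat n - 2 * of_nat \<epsilon> - 4 * of_nat i :: complex)" by simp
    then show ?thesis
      using le w_span[OF that] unfolding N.weight_vector_def simps L_act_linear(2) L_act_bvec(2)[OF le]
      by (simp only: L_act_bvec(1) if_True pm.scale_left_commute conj_ac simp_thms)
  qed
  moreover have "L_act n (uF * uF) (?w i) = ?w (Suc i)" if "i < d" for i
  proof -
    have le: "2 * i + \<epsilon> + 2 \<le> n" using that assms by simp
    have "fact (2 * i + \<epsilon>) * ((of_nat (2 * i + \<epsilon>) + 1) * (of_nat (2 * i + \<epsilon>) + 2)) =
        (fact (2 * Suc i + \<epsilon>) :: complex)"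
      by (simp add: algebra_simps)
    then show ?thesis
      using le by (simp add: L_act_linear(2) L_act_bvec(3) del: single_one fact_Suc)
  qed
  moreover have "L_act n (uF * uF) (?w d) = 0"
    using assms by (simp add: L_act_linear(2) L_act_bvec(3) del: single_one)
  moreover have "L_act n (uE * uE) (?w 0) = 0"
    using assms by (simp add: L_act_linear(2) L_act_bvec(4) del: single_one)
  ultimately show ?thesis
    unfolding N.lowering_chain_def by (simp add: simps span[unfolded pm_span_def] pm_span_def del: single_one)
qed

lemma irreducible_L_part:
  assumes "\<epsilon> \<le> 1" "2 * d + \<epsilon> \<le> n" "n \<le> 2 * d + \<epsilon> + 1"
  shows "irreducible_umod usl2_even (L_part n \<epsilon> d)" "umod_dim (L_part n \<epsilon> d) = d + 1"
proof -
  interpret N: even_module "L_part n \<epsilon> d" using assms by (rule even_module_L_part)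
  note chain = lowering_chain_L_part[OF assms]
  show "umod_dim (L_part n \<epsilon> d) = d + 1" by (rule N.lowering_chain_dim[OF chain])
  show "irreducible_umod usl2_even (L_part n \<epsilon> d)"
  proof (rule N.lowering_chain_irreducible[OF chain])
    fix i assume "i < d"
    then have "2 * i + \<epsilon> + 2 \<le> n" using assms by linarith
    then obtain k where n: "n = 2 * i + \<epsilon> + 2 + k" using le_Suc_ex by blast
    \<comment> \<open>With \<open>j = 2 i + \<epsilon>\<close>, the coefficient is \<open>(n - j) (n - j - 1) (j + 1) (j + 2)\<close>, and \<open>j + 2 \<le> n\<close>.\<close>
    define x y where "x = (of_nat n :: complex)" and "y = (of_nat (2 * i + \<epsilon>) :: complex)"
    have xy: "x - y = of_nat (k + 2)" "of_nat (k + 2) - 1 = (of_nat (k + 1) :: complex)" "y + 1 = of_nat (2 * i + \<epsilon> + 1)"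
      "y + 2 = of_nat (2 * i + \<epsilon> + 2)" by (simp_all add: x_def y_def n)
    have factors: "x * (x + 2) - (x - 2 * y)\<^sup>2 + 2 * (x - 2 * y) = 4 * ((x - y) * (y + 1))"
      "x * (x + 2) - (x - 2 * y)\<^sup>2 + 6 * (x - 2 * y) - 8 = 4 * ((x - y - 1) * (y + 2))"
      by (simp_all add: power2_eq_square algebra_simps)
    have "of_nat n - 2 * of_nat \<epsilon> - 4 * of_nat i = x - 2 * y" by (simp add: x_def y_def)
    then have "N.raising_coeff (of_nat n * (of_nat n + 2)) (of_nat n - 2 * of_nat \<epsilon> - 4 * of_nat i) =
        (x - y) * (y + 1) * ((x - y - 1) * (y + 2))"
      by (simp only: N.raising_coeff_def factors flip: x_def) simp
    also have "\<dots> \<noteq> 0" unfolding xy mult_eq_0_iff of_nat_eq_0_iff by simp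
    finally show "N.raising_coeff (of_nat n * (of_nat n + 2)) (of_nat n - 2 * of_nat \<epsilon> - 4 * of_nat i) \<noteq> 0" .
  qed
qed

lemma lookup_L_act_H:
  "Poly_Mapping.lookup (L_act n uH v) k =
    (if k \<le> n then of_nat n - 2 * of_nat k else 0) * Poly_Mapping.lookup v k"
proof (induction v rule: pm_induct)
  case (add j c v)
  have "Poly_Mapping.single j c = pm_scale c (bvec j)" by (simp add: pm_scale_single)
  with add show ?case
    by (auto simp: L_act_linear(1,2) L_act_bvec(1) lookup_add lookup_single when_def distrib_left
        simp del: single_one)
qed (simp add: L_act_linear)

text \<open>A weight vector of weight \<open>n - 4 i - 2 \<epsilon>\<close> can only have a coefficient at \<open>v\<^sub>k\<close> with
  \<open>k = 2 i + \<epsilon>\<close>.\<close>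

lemma span_weight_spaces:
  assumes "\<epsilon> \<le> 1" "2 * d + \<epsilon> \<le> n" "n \<le> 2 * d + \<epsilon> + 1"
  shows "pm_span (\<Union>i::int. weight_space (L_mod n) (of_nat n - 4 * of_int i - 2 * of_nat \<epsilon>)) =
    pm_span ((\<lambda>i. bvec (2 * i + \<epsilon>)) ` {..d})"
proof -
  let ?X = "(\<lambda>i. bvec (2 * i + \<epsilon>)) ` {..d}"
  have "v \<in> pm_span ?X" if v: "v \<in> weight_space (L_mod n) (of_nat n - 4 * of_int i - 2 * of_nat \<epsilon>)" for v i
  proof -
    have vn: "v \<in> pm_span (bvec ` {0..n})"
      and Hv: "L_act n uH v = pm_scale (of_nat n - 4 * of_int i - 2 * of_nat \<epsilon>) v"
      using v by (simp_all add: weight_space_def L_mod_def)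
    have "\<forall>k>n. Poly_Mapping.lookup v k = 0"
      using vn by (induction rule: pm.span_induct_alt) (auto simp: lookup_add lookup_single when_def simp del: single_one)
    then have keys_le: "k \<le> n" if "k \<in> Poly_Mapping.keys v" for k
      using that by (metis in_keys_iff not_le)
    have keys: "\<exists>m\<le>d. k = 2 * m + \<epsilon>" if k: "k \<in> Poly_Mapping.keys v" for k
    proof -
      have "Poly_Mapping.lookup (L_act n uH v) k =
          (of_nat n - 4 * of_int i - 2 * of_nat \<epsilon>) * Poly_Mapping.lookup v k"
        by (simp add: Hv)
      then have "of_nat n - 2 * of_nat k = (of_nat n - 4 * of_int i - 2 * of_nat \<epsilon> :: complex)"
        using keys_le[OF k] k by (simp add: lookup_L_act_H in_keys_iff)
      then have "(of_nat n - (of_nat n - 2 * of_nat k) :: complex) =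
          of_nat n - (of_nat n - 4 * of_int i - 2 * of_nat \<epsilon>)" by (rule arg_cong)
      then have "(of_int (2 * int k) :: complex) = of_int (4 * i + 2 * int \<epsilon>)" by simp
      then have "2 * int k = 4 * i + 2 * int \<epsilon>" unfolding of_int_eq_iff .
      then show ?thesis using keys_le[OF k] assms by (intro exI[of _ "nat i"]) linarith
    qed
    have "v = lin_ext bvec v"
      by (induction v rule: pm_induct) (simp_all add: lin_ext_add pm_scale_single del: single_one)
    also have "\<dots> \<in> pm_span ?X"
      unfolding lin_ext_def using keys by (intro pm.span_sum pm.span_scale pm.span_base) auto
    finally show ?thesis .
  qed
  moreover have "bvec (2 * i + \<epsilon>) \<in> weight_space (L_mod n) (of_nat n - 4 * of_int (int i) - 2 * of_nat \<epsilon>)"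
    if "i \<le> d" for i
  proof -
    have "2 * i + \<epsilon> \<le> n" using that assms by simp
    moreover from this have "bvec (2 * i + \<epsilon>) \<in> pm_span (bvec ` {0..n})" by (intro pm.span_base) auto
    ultimately show ?thesis
      by (simp add: weight_space_def L_mod_def L_act_bvec(1) del: single_one)
  qed
  ultimately show ?thesis by (subst pm.span_eq) (blast intro: pm.span_base)
qed

lemma L_mod0_eq_L_part: "2 * d \<le> n \<Longrightarrow> n \<le> 2 * d + 1 \<Longrightarrow> L_mod0 n = L_part n 0 d"
  using span_weight_spaces[of 0 d n] by (simp add: L_mod0_def L_part_def)

lemma L_mod1_eq_L_part: "2 * d + 1 \<le> n \<Longrightarrow> n \<le> 2 * d + 2 \<Longrightarrow> L_mod1 n = L_part n 1 d"
  using span_weight_spaces[of 1 d n] by (simp add: L_mod1_def L_part_def)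

section \<open>The classification\<close>

theorem theorem5p11:
  fixes d :: nat
  shows "(\<forall>M \<in> {L_mod0 (2 * d), L_mod0 (2 * d + 1), L_mod1 (2 * d + 1), L_mod1 (2 * d + 2)}.
            irreducible_umod usl2_even M \<and> umod_dim M = d + 1) \<and>
         (\<forall>V :: 'v::ab_group_add umod.
            irreducible_umod usl2_even V \<and> umod_dim V = d + 1 \<longrightarrow>
            (\<exists>M \<in> {L_mod0 (2 * d), L_mod0 (2 * d + 1), L_mod1 (2 * d + 1), L_mod1 (2 * d + 2)}.
               umod_iso usl2_even V M))"
proof -
  have eqs: "L_mod0 (2 * d) = L_part (2 * d) 0 d" "L_mod0 (2 * d + 1) = L_part (2 * d + 1) 0 d"
    "L_mod1 (2 * d + 1) = L_part (2 * d + 1) 1 d" "L_mod1 (2 * d + 2) = L_part (2 * d + 2) 1 d"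
    by (rule L_mod0_eq_L_part L_mod1_eq_L_part; simp)+
  let ?P = "{(2 * d, 0), (2 * d + 1, 0), (2 * d + 1, 1), (2 * d + 2, 1)}"
  have P: "\<epsilon> \<le> 1" "2 * d + \<epsilon> \<le> n" "n \<le> 2 * d + \<epsilon> + 1" if "(n, \<epsilon>) \<in> ?P" for n \<epsilon>
    using that by auto
  have "\<exists>(n, \<epsilon>)\<in>?P. umod_iso usl2_even V (L_part n \<epsilon> d)"
    if "irreducible_umod usl2_even V" "umod_dim V = d + 1" for V :: "'v umod"
  proof -
    interpret V: even_module V using that by (simp add: even_module_def irreducible_umod_def)
    obtain \<nu> c w where chain: "V.lowering_chain d \<nu> c w"
      using V.irreducible_has_lowering_chain \<open>irreducible_umod usl2_even V\<close> \<open>umod_dim V = d + 1\<close> by blast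
    have "\<exists>(n, \<epsilon>)\<in>?P. \<nu> = of_nat n - 2 * of_nat \<epsilon> \<and> c = of_nat n * (of_nat n + 2)"
      using V.lowering_chain_parameters[OF chain] by (auto simp: algebra_simps)
    then obtain n \<epsilon> where n: "(n, \<epsilon>) \<in> ?P" "\<nu> = of_nat n - 2 * of_nat \<epsilon>" "c = of_nat n * (of_nat n + 2)"
      by blast
    have "umod_iso usl2_even V (L_part n \<epsilon> d)"
      using lowering_chain_iso[OF V.even_module_axioms even_module_L_part[OF P[OF n(1)]]]
        chain lowering_chain_L_part[OF P[OF n(1)]] unfolding n(2,3) by blast
    with n(1) show ?thesis by blast
  qed
  then have "\<exists>M \<in> {L_part (2 * d) 0 d, L_part (2 * d + 1) 0 d, L_part (2 * d + 1) 1 d, L_part (2 * d + 2) 1 d}.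
      umod_iso usl2_even V M"
    if "irreducible_umod usl2_even V" "umod_dim V = d + 1" for V :: "'v umod"
    using that by fastforce
  moreover have "irreducible_umod usl2_even M \<and> umod_dim M = d + 1"
    if "M \<in> {L_part (2 * d) 0 d, L_part (2 * d + 1) 0 d, L_part (2 * d + 1) 1 d, L_part (2 * d + 2) 1 d}" for M
    using that irreducible_L_part by auto
  ultimately show ?thesis unfolding eqs by blast
qed

end
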